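(* Let $f_!\colon\mathcal{X}\rightleftarrows\mathcal{Y}\,{:}\,f^*$ be an adjunction ($f_!\dashv f^*$) between left closed monoidal categories such that the right adjoint $f^*\colon\mathcal{Y}\to\mathcal{X}$ is monoidal. Then the projection formula holds, i.e. the left projection operator $$\pi_{y,x}\colon f_!(f^*(y)\otimes x)\to y\otimes f_!(x)$$ is an isomorphism for all objects $x$ of $\mathcal{X}$ and $y$ of $\mathcal{Y}$, if and only if $f^*$ is strong left closed monoidal, i.e. the closed structure operator $$\overline{\omega}_{y,y'}\colon f^*(y\multimap y')\to f^*(y)\multimap f^*(y')$$ is an isomorphism for all objects $y,y'$ of $\mathcal{Y}$. In that case the inverse of the left projection operator is the conjugate of the inverse of the closed structure operator: $\pi^{-1}=j_{\mathrm{r}}(\overline{\omega}^{-1})$.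
   Context: A left closed monoidal category is a monoidal category with an internal hom functor ${\multimap}\colon\mathcal{C}^{\mathrm{op}}\times\mathcal{C}\to\mathcal{C}$ and adjunctions $c\otimes-\dashv c\multimap-$, whose counit $\mathrm{ev}_{c,a}\colon c\otimes(c\multimap a)\to a$ and unit $\mathrm{coev}_{c,a}\colon a\to c\multimap(c\otimes a)$ are natural in $a$ and extranatural in $c$. "Monoidal functor" means lax monoidal: $f^*$ is equipped with coherent natural structure maps $\omega_{y,y'}\colon f^*(y)\otimes f^*(y')\to f^*(y\otimes y')$ and a unit map, satisfying the usual axioms. Closed structure operator $\overline{\omega}_{y,y'}$: the composite $$f^*(y\multimap y')\xrightarrow{\mathrm{coev}}f^*(y)\multimap\bigl(f^*(y)\otimes f^*(y\multimap y')\bigr)\xrightarrow{\mathrm{id}\multimap\omega}f^*(y)\multimap f^*\bigl(y\otimes(y\multimap y')\bigr)\xrightarrow{\mathrm{id}\multimap f^*(\mathrm{ev})}f^*(y)\multimap f^*(y').$$ Left projection operator $\pi_{y,x}$: with $u\colon\mathrm{id}\Rightarrow f^*f_!$ and $e\colon f_!f^*\Rightarrow\mathrm{id}$ the unit and counit of $f_!\dashv f^*$, the composite $$f_!(f^*(y)\otimes x)\xrightarrow{f_!(\mathrm{id}\otimes u)}f_!\bigl(f^*(y)\otimes f^*f_!(x)\bigr)\xrightarrow{f_!(\omega)}f_!f^*\bigl(y\otimes f_!(x)\bigr)\xrightarrow{e}y\otimes f_!(x).$$ Conjugation: consider the functors $T(y,x)=f_!(f^*(y)\otimes x)$ and $T'(y,x)=y\otimes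 f_!(x)$ from $\mathcal{Y}\times\mathcal{X}$ to $\mathcal{Y}$, and $H(y,y')=f^*(y)\multimap f^*(y')$ and $H'(y,y')=f^*(y\multimap y')$ from $\mathcal{Y}^{\mathrm{op}}\times\mathcal{Y}$ to $\mathcal{X}$. For each $y$ there are adjunctions $T(y,-)\dashv H(y,-)$ and $T'(y,-)\dashv H'(y,-)$ obtained by composing $f_!\dashv f^*$ with the tensor–hom adjunctions: the first has unit $\eta_{y,x}\colon x\xrightarrow{\mathrm{coev}}f^*(y)\multimap(f^*(y)\otimes x)\xrightarrow{\mathrm{id}\multimap u}f^*(y)\multimap f^*f_!(f^*(y)\otimes x)$ and counit $f_!\bigl(f^*(y)\otimes(f^*(y)\multimap f^*(y'))\bigr)\xrightarrow{f_!(\mathrm{ev})}f_!f^*(y')\xrightarrow{e}y'$; the second has unit $x\xrightarrow{u}f^*f_!(x)\xrightarrow{f^*(\mathrm{coev})}f^*\bigl(y\multimap(y\otimes f_!(x))\bigr)$ and counit $\epsilon'_{y,y'}\colon y\otimes f_!f^*(y\multimap y')\xrightarrow{\mathrm{id}\otimes e}y\otimes(y\multimap y')\xrightarrow{\mathrm{ev}}y'$. The conjugate of a natural transformation $\psi\colon H\Rightarrow H'$ is the natural transformation $j_{\mathrm{r}}(\psi)\colon T'\Rightarrow T$ with components $$T'(y,x)\xrightarrow{T'(y,\eta_{y,x})}T'\bigl(y,H(y,T(y,x))\bigr)\xrightarrow{T'(y,\psi_{y,T(y,x)})}T'\bigl(y,H'(y,T(y,x))\bigr)\xrightarrow{\epsilon'_{y,T(y,x)}}T(y,x).$$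 *)

theory Defs
  imports Main
begin

record ('o, 'a) cat =
  Obj :: "'o set"
  Arr :: "'a set"
  Dom :: "'a \<Rightarrow> 'o"
  Cod :: "'a \<Rightarrow> 'o"
  Id :: "'o \<Rightarrow> 'a"
  Comp :: "'a \<Rightarrow> 'a \<Rightarrow> 'a"  (infixl "\<cdot>\<index>" 55)

definition Hom :: "('o, 'a, 'm) cat_scheme \<Rightarrow> 'o \<Rightarrow> 'o \<Rightarrow> 'a set" where
  "Hom C a b = {f \<in> Arr C. Dom C f = a \<and> Cod C f = b}"

locale category =
  fixes C :: "('o, 'a, 'm) cat_scheme" (structure)
  assumes Dom_Obj: "f \<in> Arr C \<Longrightarrow> Dom C f \<in> Obj C"
    and Cod_Obj: "f \<in> Arr C \<Longrightarrow> Cod C f \<in> Obj C"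
    and Id_Hom: "a \<in> Obj C \<Longrightarrow> Id C a \<in> Hom C a a"
    and Comp_Hom: "\<lbrakk>f \<in> Hom C a b; g \<in> Hom C b c\<rbrakk> \<Longrightarrow> g \<cdot> f \<in> Hom C a c"
    and Comp_Id: "f \<in> Hom C a b \<Longrightarrow> f \<cdot> Id C a = f"
    and Id_Comp: "f \<in> Hom C a b \<Longrightarrow> Id C b \<cdot> f = f"
    and Comp_assoc: "\<lbrakk>f \<in> Hom C a b; g \<in> Hom C b c; h \<in> Hom C c d\<rbrakk>
      \<Longrightarrow> h \<cdot> g \<cdot> f = h \<cdot> (g \<cdot> f)"

definition inverse_arrows :: "('o, 'a, 'm) cat_scheme \<Rightarrow> 'a \<Rightarrow> 'a \<Rightarrow> bool" where
  "inverse_arrows C f g \<longleftrightarrow>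
     f \<in> Arr C \<and> g \<in> Hom C (Cod C f) (Dom C f) \<and>
     g \<cdot>\<^bsub>C\<^esub> f = Id C (Dom C f) \<and> f \<cdot>\<^bsub>C\<^esub> g = Id C (Cod C f)"

definition is_iso :: "('o, 'a, 'm) cat_scheme \<Rightarrow> 'a \<Rightarrow> bool" where
  "is_iso C f \<longleftrightarrow> (\<exists>g. inverse_arrows C f g)"

definition inv_arr :: "('o, 'a, 'm) cat_scheme \<Rightarrow> 'a \<Rightarrow> 'a" where
  "inv_arr C f = (THE g. inverse_arrows C f g)"

definition op_cat :: "('o, 'a, 'm) cat_scheme \<Rightarrow> ('o, 'a) cat" where
  "op_cat C = \<lparr>Obj = Obj C, Arr = Arr C, Dom = Cod C, Cod = Dom C, Id = Id C,
     Comp = (\<lambda>g f. f \<cdot>\<^bsub>C\<^esub> g)\<rparr>"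

definition prod_cat :: "('o, 'a, 'm) cat_scheme \<Rightarrow> ('p, 'b, 'n) cat_scheme
    \<Rightarrow> ('o \<times> 'p, 'a \<times> 'b) cat"  (infixr "\<times>\<^sub>C" 80) where
  "C \<times>\<^sub>C D = \<lparr>Obj = Obj C \<times> Obj D, Arr = Arr C \<times> Arr D,
     Dom = (\<lambda>(f, g). (Dom C f, Dom D g)), Cod = (\<lambda>(f, g). (Cod C f, Cod D g)),
     Id = (\<lambda>(a, b). (Id C a, Id D b)),
     Comp = (\<lambda>(f', g') (f, g). (f' \<cdot>\<^bsub>C\<^esub> f, g' \<cdot>\<^bsub>D\<^esub> g))\<rparr>"

record ('o, 'a, 'p, 'b) func =
  ObF :: "'o \<Rightarrow> 'p"
  ArF :: "'a \<Rightarrow> 'b"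

definition id_func :: "('o, 'a, 'o, 'a) func" where
  "id_func = \<lparr>ObF = (\<lambda>a. a), ArF = (\<lambda>f. f)\<rparr>"

definition comp_func :: "('p, 'b, 'q, 'c) func \<Rightarrow> ('o, 'a, 'p, 'b) func \<Rightarrow> ('o, 'a, 'q, 'c) func"
    (infixl "\<circ>\<^sub>F" 55) where
  "G \<circ>\<^sub>F F = \<lparr>ObF = ObF G \<circ> ObF F, ArF = ArF G \<circ> ArF F\<rparr>"

locale cat_functor = C: category C + D: category D
  for C :: "('o, 'a, 'm) cat_scheme" and D :: "('p, 'b, 'n) cat_scheme" +
  fixes F :: "('o, 'a, 'p, 'b) func"
  assumes ObF_Obj: "a \<in> Obj C \<Longrightarrow> ObF F a \<in> Obj D"
    and ArF_Hom: "f \<in> Hom C a b \<Longrightarrow> ArF F f \<in> Hom D (ObF F a) (ObF F b)"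
    and ArF_Id: "a \<in> Obj C \<Longrightarrow> ArF F (Id C a) = Id D (ObF F a)"
    and ArF_Comp: "\<lbrakk>f \<in> Hom C a b; g \<in> Hom C b c\<rbrakk>
      \<Longrightarrow> ArF F (g \<cdot>\<^bsub>C\<^esub> f) = ArF F g \<cdot>\<^bsub>D\<^esub> ArF F f"

locale nat_trans = F: cat_functor C D F + G: cat_functor C D G
  for C :: "('o, 'a, 'm) cat_scheme" and D :: "('p, 'b, 'n) cat_scheme"
    and F :: "('o, 'a, 'p, 'b) func" and G :: "('o, 'a, 'p, 'b) func" +
  fixes \<tau> :: "'o \<Rightarrow> 'b"
  assumes component: "a \<in> Obj C \<Longrightarrow> \<tau> a \<in> Hom D (ObF F a) (ObF G a)"
    and naturality: "f \<in> Hom C a b \<Longrightarrow> \<tau> b \<cdot>\<^bsub>D\<^esub> ArF F f = ArF G f \<cdot>\<^bsub>D\<^esub> \<tau> a"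

locale adjunction = L: cat_functor X Y L + R: cat_functor Y X R +
    unit: nat_trans X X id_func "R \<circ>\<^sub>F L" u +
    counit: nat_trans Y Y "L \<circ>\<^sub>F R" id_func e
  for X :: "('o, 'a, 'm) cat_scheme" and Y :: "('p, 'b, 'n) cat_scheme"
    and L :: "('o, 'a, 'p, 'b) func" and R :: "('p, 'b, 'o, 'a) func"
    and u :: "'o \<Rightarrow> 'a" and e :: "'p \<Rightarrow> 'b" +
  assumes triangle_L: "x \<in> Obj X \<Longrightarrow> e (ObF L x) \<cdot>\<^bsub>Y\<^esub> ArF L (u x) = Id Y (ObF L x)"
    and triangle_R: "y \<in> Obj Y \<Longrightarrow> ArF R (e y) \<cdot>\<^bsub>X\<^esub> u (ObF R y) = Id X (ObF R y)"

record ('o, 'a) mon_cat = "('o, 'a) cat" +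
  Tensor :: "('o \<times> 'o, 'a \<times> 'a, 'o, 'a) func"
  Unit :: "'o"
  Assoc :: "'o \<Rightarrow> 'o \<Rightarrow> 'o \<Rightarrow> 'a"
  LUnit :: "'o \<Rightarrow> 'a"
  RUnit :: "'o \<Rightarrow> 'a"

abbreviation tensor_Ob :: "('o, 'a, 'm) mon_cat_scheme \<Rightarrow> 'o \<Rightarrow> 'o \<Rightarrow> 'o"
    (infixl "\<otimes>\<index>" 70) where
  "a \<otimes>\<^bsub>C\<^esub> b \<equiv> ObF (Tensor C) (a, b)"

abbreviation tensor_Ar :: "('o, 'a, 'm) mon_cat_scheme \<Rightarrow> 'a \<Rightarrow> 'a \<Rightarrow> 'a"
    (infixl "\<otimes>\<^sub>a\<index>" 70) where
  "f \<otimes>\<^sub>a\<^bsub>C\<^esub> g \<equiv> ArF (Tensor C) (f, g)"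

locale monoidal_category = category C + tensor: cat_functor "C \<times>\<^sub>C C" C "Tensor C" +
    assoc: nat_trans "(C \<times>\<^sub>C C) \<times>\<^sub>C C" C
      "\<lparr>ObF = (\<lambda>((a, b), c). (a \<otimes>\<^bsub>C\<^esub> b) \<otimes>\<^bsub>C\<^esub> c),
        ArF = (\<lambda>((f, g), h). (f \<otimes>\<^sub>a\<^bsub>C\<^esub> g) \<otimes>\<^sub>a\<^bsub>C\<^esub> h)\<rparr>"
      "\<lparr>ObF = (\<lambda>((a, b), c). a \<otimes>\<^bsub>C\<^esub> (b \<otimes>\<^bsub>C\<^esub> c)),
        ArF = (\<lambda>((f, g), h). f \<otimes>\<^sub>a\<^bsub>C\<^esub> (g \<otimes>\<^sub>a\<^bsub>C\<^esub> h))\<rparr>"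
      "\<lambda>((a, b), c). Assoc C a b c" +
    lunit: nat_trans C C
      "\<lparr>ObF = (\<lambda>a. Unit C \<otimes>\<^bsub>C\<^esub> a), ArF = (\<lambda>f. Id C (Unit C) \<otimes>\<^sub>a\<^bsub>C\<^esub> f)\<rparr>" id_func "LUnit C" +
    runit: nat_trans C C
      "\<lparr>ObF = (\<lambda>a. a \<otimes>\<^bsub>C\<^esub> Unit C), ArF = (\<lambda>f. f \<otimes>\<^sub>a\<^bsub>C\<^esub> Id C (Unit C))\<rparr>" id_func "RUnit C"
  for C :: "('o, 'a, 'm) mon_cat_scheme" (structure) +
  assumes Unit_Obj: "Unit C \<in> Obj C"
    and Assoc_iso: "\<lbrakk>a \<in> Obj C; b \<in> Obj C; c \<in> Obj C\<rbrakk> \<Longrightarrow> is_iso C (Assoc C a b c)"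
    and LUnit_iso: "a \<in> Obj C \<Longrightarrow> is_iso C (LUnit C a)"
    and RUnit_iso: "a \<in> Obj C \<Longrightarrow> is_iso C (RUnit C a)"
    and pentagon: "\<lbrakk>a \<in> Obj C; b \<in> Obj C; c \<in> Obj C; d \<in> Obj C\<rbrakk> \<Longrightarrow>
      (Id C a \<otimes>\<^sub>a Assoc C b c d) \<cdot> Assoc C a (b \<otimes> c) d \<cdot> (Assoc C a b c \<otimes>\<^sub>a Id C d)
        = Assoc C a b (c \<otimes> d) \<cdot> Assoc C (a \<otimes> b) c d"
    and triangle: "\<lbrakk>a \<in> Obj C; b \<in> Obj C\<rbrakk> \<Longrightarrow>
      (Id C a \<otimes>\<^sub>a LUnit C b) \<cdot> Assoc C a (Unit C) b = RUnit C a \<otimes>\<^sub>a Id C b"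

record ('o, 'a) closed_mon_cat = "('o, 'a) mon_cat" +
  IHom :: "('o \<times> 'o, 'a \<times> 'a, 'o, 'a) func"
  Ev :: "'o \<Rightarrow> 'o \<Rightarrow> 'a"
  Coev :: "'o \<Rightarrow> 'o \<Rightarrow> 'a"

abbreviation ihom_Ob :: "('o, 'a, 'm) closed_mon_cat_scheme \<Rightarrow> 'o \<Rightarrow> 'o \<Rightarrow> 'o"
    (infixr "\<rightharpoonup>\<index>" 65) where
  "a \<rightharpoonup>\<^bsub>C\<^esub> b \<equiv> ObF (IHom C) (a, b)"

abbreviation ihom_Ar :: "('o, 'a, 'm) closed_mon_cat_scheme \<Rightarrow> 'a \<Rightarrow> 'a \<Rightarrow> 'a"
    (infixr "\<rightharpoonup>\<^sub>a\<index>" 65) where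
  "f \<rightharpoonup>\<^sub>a\<^bsub>C\<^esub> g \<equiv> ArF (IHom C) (f, g)"

text \<open>
  The functor \<open>IHom C\<close> is contravariant in its first argument: for \<open>f : c \<rightarrow> c'\<close> and \<open>g : a \<rightarrow> a'\<close>
  in \<open>C\<close>, the arrow \<open>f \<rightharpoonup>\<^sub>a g\<close> goes from \<open>c' \<rightharpoonup> a\<close> to \<open>c \<rightharpoonup> a'\<close>.
\<close>

locale left_closed_monoidal_category = monoidal_category C +
    ihom: cat_functor "op_cat C \<times>\<^sub>C C" C "IHom C"
  for C :: "('o, 'a, 'm) closed_mon_cat_scheme" (structure) +
  assumes tensor_hom_adjunction: "c \<in> Obj C \<Longrightarrow>
      adjunction C C
        \<lparr>ObF = (\<lambda>a. c \<otimes> a), ArF = (\<lambda>f. Id C c \<otimes>\<^sub>a f)\<rparr>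
        \<lparr>ObF = (\<lambda>a. c \<rightharpoonup> a), ArF = (\<lambda>f. Id C c \<rightharpoonup>\<^sub>a f)\<rparr>
        (\<lambda>a. Coev C c a) (\<lambda>a. Ev C c a)"
    and Ev_extranatural: "\<lbrakk>f \<in> Hom C c c'; a \<in> Obj C\<rbrakk> \<Longrightarrow>
      Ev C c a \<cdot> (Id C c \<otimes>\<^sub>a (f \<rightharpoonup>\<^sub>a Id C a)) = Ev C c' a \<cdot> (f \<otimes>\<^sub>a Id C (c' \<rightharpoonup> a))"
    and Coev_extranatural: "\<lbrakk>f \<in> Hom C c c'; a \<in> Obj C\<rbrakk> \<Longrightarrow>
      (Id C c \<rightharpoonup>\<^sub>a (f \<otimes>\<^sub>a Id C a)) \<cdot> Coev C c a = (f \<rightharpoonup>\<^sub>a Id C (c' \<otimes> a)) \<cdot> Coev C c' a"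

text \<open>``Monoidal functor'' means lax monoidal functor.\<close>

locale monoidal_functor = Y: monoidal_category Y + X: monoidal_category X + cat_functor Y X F +
    lax: nat_trans "Y \<times>\<^sub>C Y" X
      "\<lparr>ObF = (\<lambda>(y, y'). ObF F y \<otimes>\<^bsub>X\<^esub> ObF F y'), ArF = (\<lambda>(f, g). ArF F f \<otimes>\<^sub>a\<^bsub>X\<^esub> ArF F g)\<rparr>"
      "F \<circ>\<^sub>F Tensor Y"
      "\<lambda>(y, y'). \<omega> y y'"
  for Y :: "('p, 'b, 'n) mon_cat_scheme" and X :: "('o, 'a, 'm) mon_cat_scheme"
    and F :: "('p, 'b, 'o, 'a) func" and \<omega> :: "'p \<Rightarrow> 'p \<Rightarrow> 'a" and \<omega>\<^sub>0 :: "'a" +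
  assumes lax_unit: "\<omega>\<^sub>0 \<in> Hom X (Unit X) (ObF F (Unit Y))"
    and lax_assoc: "\<lbrakk>a \<in> Obj Y; b \<in> Obj Y; c \<in> Obj Y\<rbrakk> \<Longrightarrow>
      ArF F (Assoc Y a b c) \<cdot>\<^bsub>X\<^esub> \<omega> (a \<otimes>\<^bsub>Y\<^esub> b) c \<cdot>\<^bsub>X\<^esub> (\<omega> a b \<otimes>\<^sub>a\<^bsub>X\<^esub> Id X (ObF F c))
        = \<omega> a (b \<otimes>\<^bsub>Y\<^esub> c) \<cdot>\<^bsub>X\<^esub> (Id X (ObF F a) \<otimes>\<^sub>a\<^bsub>X\<^esub> \<omega> b c)
            \<cdot>\<^bsub>X\<^esub> Assoc X (ObF F a) (ObF F b) (ObF F c)"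
    and lax_lunit: "a \<in> Obj Y \<Longrightarrow>
      ArF F (LUnit Y a) \<cdot>\<^bsub>X\<^esub> \<omega> (Unit Y) a \<cdot>\<^bsub>X\<^esub> (\<omega>\<^sub>0 \<otimes>\<^sub>a\<^bsub>X\<^esub> Id X (ObF F a)) = LUnit X (ObF F a)"
    and lax_runit: "a \<in> Obj Y \<Longrightarrow>
      ArF F (RUnit Y a) \<cdot>\<^bsub>X\<^esub> \<omega> a (Unit Y) \<cdot>\<^bsub>X\<^esub> (Id X (ObF F a) \<otimes>\<^sub>a\<^bsub>X\<^esub> \<omega>\<^sub>0) = RUnit X (ObF F a)"

text \<open>
  In the following, \<open>L\<close> and \<open>R\<close> stand for \<open>f\<^sub>!\<close> and \<open>f\<^sup>*\<close>, with unit \<open>u\<close> and counit \<open>e\<close>.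
\<close>

definition closed_structure ::
  "('o, 'a, 'm) closed_mon_cat_scheme \<Rightarrow> ('p, 'b, 'n) closed_mon_cat_scheme \<Rightarrow>
   ('p, 'b, 'o, 'a) func \<Rightarrow> ('p \<Rightarrow> 'p \<Rightarrow> 'a) \<Rightarrow> 'p \<Rightarrow> 'p \<Rightarrow> 'a" where
  "closed_structure X Y R \<omega> y y' =
     (Id X (ObF R y) \<rightharpoonup>\<^sub>a\<^bsub>X\<^esub> ArF R (Ev Y y y'))
     \<cdot>\<^bsub>X\<^esub> (Id X (ObF R y) \<rightharpoonup>\<^sub>a\<^bsub>X\<^esub> \<omega> y (y \<rightharpoonup>\<^bsub>Y\<^esub> y'))
     \<cdot>\<^bsub>X\<^esub> Coev X (ObF R y) (ObF R (y \<rightharpoonup>\<^bsub>Y\<^esub> y'))"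

definition left_projection ::
  "('o, 'a, 'm) closed_mon_cat_scheme \<Rightarrow> ('p, 'b, 'n) closed_mon_cat_scheme \<Rightarrow>
   ('o, 'a, 'p, 'b) func \<Rightarrow> ('p, 'b, 'o, 'a) func \<Rightarrow> ('o \<Rightarrow> 'a) \<Rightarrow> ('p \<Rightarrow> 'b) \<Rightarrow>
   ('p \<Rightarrow> 'p \<Rightarrow> 'a) \<Rightarrow> 'p \<Rightarrow> 'o \<Rightarrow> 'b" where
  "left_projection X Y L R u e \<omega> y x =
     e (y \<otimes>\<^bsub>Y\<^esub> ObF L x)
     \<cdot>\<^bsub>Y\<^esub> ArF L (\<omega> y (ObF L x))
     \<cdot>\<^bsub>Y\<^esub> ArF L (Id X (ObF R y) \<otimes>\<^sub>a\<^bsub>X\<^esub> u x)"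

definition projection_formula ::
  "('o, 'a, 'm) closed_mon_cat_scheme \<Rightarrow> ('p, 'b, 'n) closed_mon_cat_scheme \<Rightarrow>
   ('o, 'a, 'p, 'b) func \<Rightarrow> ('p, 'b, 'o, 'a) func \<Rightarrow> ('o \<Rightarrow> 'a) \<Rightarrow> ('p \<Rightarrow> 'b) \<Rightarrow>
   ('p \<Rightarrow> 'p \<Rightarrow> 'a) \<Rightarrow> bool" where
  "projection_formula X Y L R u e \<omega> \<longleftrightarrow>
     (\<forall>x\<in>Obj X. \<forall>y\<in>Obj Y. is_iso Y (left_projection X Y L R u e \<omega> y x))"

definition strong_left_closed ::
  "('o, 'a, 'm) closed_mon_cat_scheme \<Rightarrow> ('p, 'b, 'n) closed_mon_cat_scheme \<Rightarrow>
   ('p, 'b, 'o, 'a) func \<Rightarrow> ('p \<Rightarrow> 'p \<Rightarrow> 'a) \<Rightarrow> bool" where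
  "strong_left_closed X Y R \<omega> \<longleftrightarrow>
     (\<forall>y\<in>Obj Y. \<forall>y'\<in>Obj Y. is_iso X (closed_structure X Y R \<omega> y y'))"

definition T_func ::
  "('o, 'a, 'm) closed_mon_cat_scheme \<Rightarrow> ('o, 'a, 'p, 'b) func \<Rightarrow> ('p, 'b, 'o, 'a) func \<Rightarrow>
   ('p \<times> 'o, 'b \<times> 'a, 'p, 'b) func" where
  "T_func X L R = \<lparr>ObF = (\<lambda>(y, x). ObF L (ObF R y \<otimes>\<^bsub>X\<^esub> x)),
                   ArF = (\<lambda>(g, f). ArF L (ArF R g \<otimes>\<^sub>a\<^bsub>X\<^esub> f))\<rparr>"

definition T'_func ::
  "('p, 'b, 'n) closed_mon_cat_scheme \<Rightarrow> ('o, 'a, 'p, 'b) func \<Rightarrow>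
   ('p \<times> 'o, 'b \<times> 'a, 'p, 'b) func" where
  "T'_func Y L = \<lparr>ObF = (\<lambda>(y, x). y \<otimes>\<^bsub>Y\<^esub> ObF L x),
                  ArF = (\<lambda>(g, f). g \<otimes>\<^sub>a\<^bsub>Y\<^esub> ArF L f)\<rparr>"

definition H_func ::
  "('o, 'a, 'm) closed_mon_cat_scheme \<Rightarrow> ('p, 'b, 'o, 'a) func \<Rightarrow>
   ('p \<times> 'p, 'b \<times> 'b, 'o, 'a) func" where
  "H_func X R = \<lparr>ObF = (\<lambda>(y, y'). ObF R y \<rightharpoonup>\<^bsub>X\<^esub> ObF R y'),
                 ArF = (\<lambda>(g, g'). ArF R g \<rightharpoonup>\<^sub>a\<^bsub>X\<^esub> ArF R g')\<rparr>"

definition H'_func ::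
  "('p, 'b, 'n) closed_mon_cat_scheme \<Rightarrow> ('p, 'b, 'o, 'a) func \<Rightarrow>
   ('p \<times> 'p, 'b \<times> 'b, 'o, 'a) func" where
  "H'_func Y R = R \<circ>\<^sub>F IHom Y"

text \<open>
  \<open>TH_unit\<close> is the unit of the composite adjunction \<open>T(y, -) -| H(y, -)\<close>, and \<open>TH'_counit\<close> the
  counit of the composite adjunction \<open>T'(y, -) -| H'(y, -)\<close>.
\<close>

definition TH_unit ::
  "('o, 'a, 'm) closed_mon_cat_scheme \<Rightarrow> ('p, 'b, 'o, 'a) func \<Rightarrow> ('o \<Rightarrow> 'a) \<Rightarrow>
   'p \<Rightarrow> 'o \<Rightarrow> 'a" where
  "TH_unit X R u y x =
     (Id X (ObF R y) \<rightharpoonup>\<^sub>a\<^bsub>X\<^esub> u (ObF R y \<otimes>\<^bsub>X\<^esub> x)) \<cdot>\<^bsub>X\<^esub> Coev X (ObF R y) x"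

definition TH'_counit ::
  "('p, 'b, 'n) closed_mon_cat_scheme \<Rightarrow> ('p \<Rightarrow> 'b) \<Rightarrow> 'p \<Rightarrow> 'p \<Rightarrow> 'b" where
  "TH'_counit Y e y y' = Ev Y y y' \<cdot>\<^bsub>Y\<^esub> (Id Y y \<otimes>\<^sub>a\<^bsub>Y\<^esub> e (y \<rightharpoonup>\<^bsub>Y\<^esub> y'))"

text \<open>Here \<open>\<psi>\<close> is a natural transformation from \<open>H\<close> to \<open>H'\<close>, and \<open>conjugate\<close> is \<open>j\<^sub>r(\<psi>)\<close>.\<close>

definition conjugate ::
  "('o, 'a, 'm) closed_mon_cat_scheme \<Rightarrow> ('p, 'b, 'n) closed_mon_cat_scheme \<Rightarrow>
   ('o, 'a, 'p, 'b) func \<Rightarrow> ('p, 'b, 'o, 'a) func \<Rightarrow> ('o \<Rightarrow> 'a) \<Rightarrow> ('p \<Rightarrow> 'b) \<Rightarrow>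
   ('p \<Rightarrow> 'p \<Rightarrow> 'a) \<Rightarrow> 'p \<Rightarrow> 'o \<Rightarrow> 'b" where
  "conjugate X Y L R u e \<psi> y x =
     (let t = ObF (T_func X L R) (y, x) in
       TH'_counit Y e y t
       \<cdot>\<^bsub>Y\<^esub> ArF (T'_func Y L) (Id Y y, \<psi> y t)
       \<cdot>\<^bsub>Y\<^esub> ArF (T'_func Y L) (Id Y y, TH_unit X R u y x))"

end

theory Submission
  imports Defs
begin

text \<open>
  The projection formula and strong left closedness are two faces of one invertibility statement.
  Fix \<open>y\<close>. The functors \<open>T(y, -)\<close> and \<open>T'(y, -)\<close> have right adjoints \<open>H(y, -)\<close> and \<open>H'(y, -)\<close>,
  and the transformations \<open>\<pi> : T(y, -) \<Rightarrow> T'(y, -)\<close> and \<open>\<omega>bar : H'(y, -) \<Rightarrow> H(y, -)\<close> are conjugate: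
  under the adjunction bijections, precomposition with \<open>\<pi>\<close>, a map from \<open>Y(T'(y, x), y')\<close> to
  \<open>Y(T(y, x), y')\<close>, is postcomposition with \<open>\<omega>bar\<close>, a map from \<open>X(x, H'(y, y'))\<close> to
  \<open>X(x, H(y, y'))\<close>. By the Yoneda lemma the first is bijective for all \<open>y'\<close> iff \<open>\<pi>\<close> is invertible,
  and the second for all \<open>x\<close> iff \<open>\<omega>bar\<close> is. Since conjugation reverses composition and preserves
  identities, the inverse of \<open>\<pi>\<close> must be the conjugate of the inverse of \<open>\<omega>bar\<close>.

  The proof replaces the appeal to Yoneda by explicit inverses. The locale \<open>conjugate_pair\<close> treats
  two arbitrary adjunctions between the same categories together with transformations that agree
  after pairing with the counits; \<open>left_inverse_if_right_iso\<close> and \<open>right_inverse_if_left_iso\<close>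
  compute the inverse on either side as the conjugate of the inverse on the other. The link to
  monoidal categories is \<open>conjugate_square\<close>: both sides of the counit condition for \<open>\<pi>\<close> and
  \<open>\<omega>bar\<close> are the transpose along \<open>L\<close> and \<open>R\<close> of the single arrow
  \<open>R y \<otimes> R (y \<rightharpoonup> y') \<rightarrow> R (y \<otimes> (y \<rightharpoonup> y')) \<rightarrow> R y'\<close> made from \<open>\<omega>\<close> and evaluation.
  Naturality of the inverses in both variables comes from that of \<open>\<pi>\<close> and \<open>\<omega>bar\<close>.
\<close>

section \<open>Arrows\<close>

text \<open>
  Typing conditions in the form of equations on \<open>Dom\<close> and \<open>Cod\<close> can be discharged by rewriting,
  whereas membership in \<open>Hom\<close> would force the intermediate objects to be guessed. The basic laws
  are therefore restated in this form.
\<close>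

lemma Hom_iff: "f \<in> Hom C a b \<longleftrightarrow> f \<in> Arr C \<and> Dom C f = a \<and> Cod C f = b"
  by (auto simp: Hom_def)

context category
begin

lemma Dom_Obj' [simp]: "f \<in> Arr C \<Longrightarrow> Dom C f \<in> Obj C"
  by (rule Dom_Obj)

lemma Cod_Obj' [simp]: "f \<in> Arr C \<Longrightarrow> Cod C f \<in> Obj C"
  by (rule Cod_Obj)

lemma Id_arrow [simp]:
  assumes "a \<in> Obj C"
  shows "Id C a \<in> Arr C" "Dom C (Id C a) = a" "Cod C (Id C a) = a"
  using Id_Hom[OF assms] by (auto simp: Hom_iff)

lemma Comp_arrow [simp]:
  assumes "f \<in> Arr C" "g \<in> Arr C" "Dom C g = Cod C f"
  shows "g \<cdot> f \<in> Arr C" "Dom C (g \<cdot> f) = Dom C f" "Cod C (g \<cdot> f) = Cod C g"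
  using Comp_Hom[of f "Dom C f" "Cod C f" g "Cod C g"] assms by (auto simp: Hom_iff)

lemma Comp_Id_eq [simp]: "\<lbrakk>f \<in> Arr C; Dom C f = a\<rbrakk> \<Longrightarrow> f \<cdot> Id C a = f"
  using Comp_Id by (auto simp: Hom_iff)

lemma Id_Comp_eq [simp]: "\<lbrakk>f \<in> Arr C; Cod C f = b\<rbrakk> \<Longrightarrow> Id C b \<cdot> f = f"
  using Id_Comp by (auto simp: Hom_iff)

lemma Comp_assoc_eq [simp]:
  "\<lbrakk>f \<in> Arr C; g \<in> Arr C; h \<in> Arr C; Dom C g = Cod C f; Dom C h = Cod C g\<rbrakk>
    \<Longrightarrow> h \<cdot> g \<cdot> f = h \<cdot> (g \<cdot> f)"
  using Comp_assoc by (auto simp: Hom_iff)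

text \<open>
  Composites are normalised to right-nested form, where the left-hand side of an equation
  \<open>g \<cdot> f = h\<close> no longer occurs as a subterm once something is precomposed. This lemma turns such an
  equation into the rewrite rule that applies there.
\<close>

lemma Comp_eq_extend:
  assumes "g \<cdot> f = h"
    and "f \<in> Arr C" "g \<in> Arr C" "k \<in> Arr C" "Dom C g = Cod C f" "Dom C f = Cod C k"
  shows "g \<cdot> (f \<cdot> k) = h \<cdot> k"
  using assms Comp_assoc_eq[of k f g] by simp

lemma inverse_arrows_unique:
  assumes "inverse_arrows C f g" "inverse_arrows C f h"
  shows "g = h"
proof -
  have "g = g \<cdot> Id C (Cod C f)"
    using assms(1) by (simp add: inverse_arrows_def Hom_iff)
  also have "Id C (Cod C f) = f \<cdot> h"
    using assms(2) by (simp add: inverse_arrows_def)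
  also have "g \<cdot> (f \<cdot> h) = g \<cdot> f \<cdot> h"
    using assms by (intro Comp_assoc_eq[symmetric]) (simp_all add: inverse_arrows_def Hom_iff)
  also have "\<dots> = h"
    using assms by (simp add: inverse_arrows_def Hom_iff)
  finally show ?thesis .
qed

lemma inv_arr_eq: "inverse_arrows C f g \<Longrightarrow> inv_arr C f = g"
  unfolding inv_arr_def by (blast intro: inverse_arrows_unique)

lemma inverse_arrows_inv_arr: "is_iso C f \<Longrightarrow> inverse_arrows C f (inv_arr C f)"
  unfolding is_iso_def using inv_arr_eq by auto

lemma inv_arr_arrow [simp]:
  assumes "is_iso C f"
  shows "inv_arr C f \<in> Arr C" "Dom C (inv_arr C f) = Cod C f" "Cod C (inv_arr C f) = Dom C f"
    "inv_arr C f \<cdot> f = Id C (Dom C f)" "f \<cdot> inv_arr C f = Id C (Cod C f)"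
  using inverse_arrows_inv_arr[OF assms] by (auto simp: inverse_arrows_def Hom_iff)

end

lemma op_cat_simps [simp]:
  "Obj (op_cat C) = Obj C" "Arr (op_cat C) = Arr C" "Dom (op_cat C) = Cod C"
  "Cod (op_cat C) = Dom C" "Id (op_cat C) = Id C" "Comp (op_cat C) g f = f \<cdot>\<^bsub>C\<^esub> g"
  by (simp_all add: op_cat_def)

lemma prod_cat_simps [simp]:
  "Obj (C \<times>\<^sub>C D) = Obj C \<times> Obj D" "Arr (C \<times>\<^sub>C D) = Arr C \<times> Arr D"
  "Dom (C \<times>\<^sub>C D) (f, g) = (Dom C f, Dom D g)" "Cod (C \<times>\<^sub>C D) (f, g) = (Cod C f, Cod D g)"
  "Id (C \<times>\<^sub>C D) (a, b) = (Id C a, Id D b)"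
  "Comp (C \<times>\<^sub>C D) (f', g') (f, g) = (f' \<cdot>\<^bsub>C\<^esub> f, g' \<cdot>\<^bsub>D\<^esub> g)"
  by (simp_all add: prod_cat_def)

lemma category_op_cat:
  assumes "category C"
  shows "category (op_cat C)"
proof -
  interpret C: category C by fact
  show ?thesis
    by unfold_locales (auto simp: Hom_iff)
qed

lemma category_prod_cat:
  assumes "category C" "category D"
  shows "category (C \<times>\<^sub>C D)"
proof -
  interpret C: category C by fact
  interpret D: category D by fact
  show ?thesis
    by unfold_locales (auto simp: Hom_iff)
qed

section \<open>Functors and natural transformations\<close>

lemma func_simps [simp]:
  "ObF id_func a = a" "ArF id_func f = f"
  "ObF (G \<circ>\<^sub>F F) a = ObF G (ObF F a)" "ArF (G \<circ>\<^sub>F F) f = ArF G (ArF F f)"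
  by (simp_all add: id_func_def comp_func_def)

context cat_functor
begin

declare ObF_Obj [simp] ArF_Id [simp]

lemma ArF_arrow [simp]:
  assumes "f \<in> Arr C"
  shows "ArF F f \<in> Arr D" "Dom D (ArF F f) = ObF F (Dom C f)" "Cod D (ArF F f) = ObF F (Cod C f)"
  using ArF_Hom[of f "Dom C f" "Cod C f"] assms by (auto simp: Hom_iff)

lemma ArF_Comp_eq:
  "\<lbrakk>f \<in> Arr C; g \<in> Arr C; Dom C g = Cod C f\<rbrakk> \<Longrightarrow> ArF F (g \<cdot>\<^bsub>C\<^esub> f) = ArF F g \<cdot>\<^bsub>D\<^esub> ArF F f"
  using ArF_Comp by (auto simp: Hom_iff)

end

lemma cat_functorI:
  assumes "category C" "category D"
    and "\<And>a. a \<in> Obj C \<Longrightarrow> ObF F a \<in> Obj D"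
    and "\<And>f. f \<in> Arr C \<Longrightarrow> ArF F f \<in> Arr D"
    and "\<And>f. f \<in> Arr C \<Longrightarrow> Dom D (ArF F f) = ObF F (Dom C f)"
    and "\<And>f. f \<in> Arr C \<Longrightarrow> Cod D (ArF F f) = ObF F (Cod C f)"
    and "\<And>a. a \<in> Obj C \<Longrightarrow> ArF F (Id C a) = Id D (ObF F a)"
    and "\<And>f g. \<lbrakk>f \<in> Arr C; g \<in> Arr C; Dom C g = Cod C f\<rbrakk>
      \<Longrightarrow> ArF F (g \<cdot>\<^bsub>C\<^esub> f) = ArF F g \<cdot>\<^bsub>D\<^esub> ArF F f"
  shows "cat_functor C D F"
  using assms by (simp add: cat_functor_def cat_functor_axioms_def Hom_iff)

lemma cat_functor_comp:
  assumes "cat_functor A B F" "cat_functor B C G"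
  shows "cat_functor A C (G \<circ>\<^sub>F F)"
proof -
  interpret F: cat_functor A B F by fact
  interpret G: cat_functor B C G by fact
  show ?thesis
    by (rule cat_functorI)
      (simp_all add: F.C.category_axioms G.D.category_axioms F.ArF_Comp_eq G.ArF_Comp_eq)
qed

context nat_trans
begin

lemma component_arrow [simp]:
  assumes "a \<in> Obj C"
  shows "\<tau> a \<in> Arr D" "Dom D (\<tau> a) = ObF F a" "Cod D (\<tau> a) = ObF G a"
  using component[OF assms] by (auto simp: Hom_iff)

lemma naturality_eq: "f \<in> Arr C \<Longrightarrow> \<tau> (Cod C f) \<cdot>\<^bsub>D\<^esub> ArF F f = ArF G f \<cdot>\<^bsub>D\<^esub> \<tau> (Dom C f)"
  using naturality by (auto simp: Hom_iff)

end

lemma nat_transI: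
  assumes "cat_functor C D F" "cat_functor C D G"
    and "\<And>a. a \<in> Obj C \<Longrightarrow> \<tau> a \<in> Arr D"
    and "\<And>a. a \<in> Obj C \<Longrightarrow> Dom D (\<tau> a) = ObF F a"
    and "\<And>a. a \<in> Obj C \<Longrightarrow> Cod D (\<tau> a) = ObF G a"
    and "\<And>f. f \<in> Arr C \<Longrightarrow> \<tau> (Cod C f) \<cdot>\<^bsub>D\<^esub> ArF F f = ArF G f \<cdot>\<^bsub>D\<^esub> \<tau> (Dom C f)"
  shows "nat_trans C D F G \<tau>"
  using assms by (auto simp add: nat_trans_def nat_trans_axioms_def Hom_iff)

lemma nat_trans_inverse:
  assumes "nat_trans C D F G \<tau>" and iso: "\<And>a. a \<in> Obj C \<Longrightarrow> is_iso D (\<tau> a)"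
  shows "nat_trans C D G F (\<lambda>a. inv_arr D (\<tau> a))"
proof -
  interpret \<tau>: nat_trans C D F G \<tau> by fact
  show ?thesis
  proof (rule nat_transI)
    fix f assume f: "f \<in> Arr C"
    let ?a = "Dom C f" and ?b = "Cod C f"
    note iso' = iso[of ?a] iso[of ?b]
    have "inv_arr D (\<tau> ?b) \<cdot>\<^bsub>D\<^esub> ArF G f
        = inv_arr D (\<tau> ?b) \<cdot>\<^bsub>D\<^esub> (ArF G f \<cdot>\<^bsub>D\<^esub> (\<tau> ?a \<cdot>\<^bsub>D\<^esub> inv_arr D (\<tau> ?a)))"
      using f iso' by simp
    also have "\<dots> = inv_arr D (\<tau> ?b) \<cdot>\<^bsub>D\<^esub> (\<tau> ?b \<cdot>\<^bsub>D\<^esub> (ArF F f \<cdot>\<^bsub>D\<^esub> inv_arr D (\<tau> ?a)))"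
      using f iso'
      by (simp del: \<tau>.F.D.inv_arr_arrow(5)
          add: \<tau>.F.D.Comp_eq_extend[OF \<tau>.naturality_eq[OF f]])
    also have "\<dots> = ArF F f \<cdot>\<^bsub>D\<^esub> inv_arr D (\<tau> ?a)"
      using f iso' by (simp add: \<tau>.F.D.Comp_eq_extend[OF \<tau>.F.D.inv_arr_arrow(4)])
    finally show "inv_arr D (\<tau> ?b) \<cdot>\<^bsub>D\<^esub> ArF G f = ArF F f \<cdot>\<^bsub>D\<^esub> inv_arr D (\<tau> ?a)" .
  qed (simp_all add: iso \<tau>.F.cat_functor_axioms \<tau>.G.cat_functor_axioms)
qed

text \<open>
  The partial functor \<open>S(a, -)\<close> of a functor of two variables; the category \<open>A\<close> supplies the
  identity arrow at which the first variable is held.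
\<close>

definition fix_first :: "('o, 'a, 'm) cat_scheme \<Rightarrow> 'o \<Rightarrow>
    ('o \<times> 'p, 'a \<times> 'b, 'q, 'c) func \<Rightarrow> ('p, 'b, 'q, 'c) func" where
  "fix_first A a S = \<lparr>ObF = (\<lambda>b. ObF S (a, b)), ArF = (\<lambda>g. ArF S (Id A a, g))\<rparr>"

lemma nat_trans_fix_first:
  assumes \<tau>: "nat_trans (A \<times>\<^sub>C B) C S S' \<tau>" and "category A" "category B" and a: "a \<in> Obj A"
  shows "nat_trans B C (fix_first A a S) (fix_first A a S') (\<lambda>b. \<tau> (a, b))"
proof -
  interpret \<tau>: nat_trans "A \<times>\<^sub>C B" C S S' \<tau> by fact
  interpret A: category A by fact
  interpret B: category B by fact
  have partial: "cat_functor B C (fix_first A a T)" if "cat_functor (A \<times>\<^sub>C B) C T" for T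
  proof -
    interpret T: cat_functor "A \<times>\<^sub>C B" C T by fact
    show ?thesis
      using a T.ArF_Id[of "(a, _)"] T.ArF_Comp_eq[of "(Id A a, _)" "(Id A a, _)"]
      by (intro cat_functorI)
        (simp_all add: fix_first_def B.category_axioms \<tau>.F.D.category_axioms)
  qed
  show ?thesis
    using a \<tau>.naturality_eq[of "(Id A a, _)"]
    by (intro nat_transI partial \<tau>.F.cat_functor_axioms \<tau>.G.cat_functor_axioms)
      (simp_all add: fix_first_def)
qed

section \<open>Adjunctions and conjugate transformations\<close>

context adjunction
begin

lemma transpose_counit:
  assumes f: "f \<in> Arr Y" "Dom Y f = ObF L x" and x: "x \<in> Obj X"
  shows "e (Cod Y f) \<cdot>\<^bsub>Y\<^esub> ArF L (ArF R f \<cdot>\<^bsub>X\<^esub> u x) = f"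
  using assms counit.naturality_eq[of f]
    L.D.Comp_eq_extend[of "e (Cod Y f)" "ArF L (ArF R f)" _ "ArF L (u x)"]
  by (simp add: L.ArF_Comp_eq triangle_L)

text \<open>
  The transpose of an arrow determines it, because \<open>g\<close> is recovered from its transpose as
  \<open>R (e y \<cdot> L g) \<cdot> u x\<close> by the second triangle identity.
\<close>

lemma transpose_inject:
  assumes gh: "g \<in> Hom X x (ObF R y)" "h \<in> Hom X x (ObF R y)" and y: "y \<in> Obj Y"
    and eq: "e y \<cdot>\<^bsub>Y\<^esub> ArF L g = e y \<cdot>\<^bsub>Y\<^esub> ArF L h"
  shows "g = h"
proof -
  have recover: "k = ArF R (e y \<cdot>\<^bsub>Y\<^esub> ArF L k) \<cdot>\<^bsub>X\<^esub> u x" if "k \<in> Hom X x (ObF R y)" for k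
  proof -
    have k: "k \<in> Arr X" "Dom X k = x" "Cod X k = ObF R y"
      using that by (auto simp: Hom_iff)
    have "ArF R (e y \<cdot>\<^bsub>Y\<^esub> ArF L k) \<cdot>\<^bsub>X\<^esub> u x = ArF R (e y) \<cdot>\<^bsub>X\<^esub> (u (ObF R y) \<cdot>\<^bsub>X\<^esub> k)"
      using k y unit.naturality_eq[of k] L.C.Dom_Obj[of k] by (simp add: R.ArF_Comp_eq)
    also have "\<dots> = k"
      using k y by (simp add: L.C.Comp_eq_extend[OF triangle_R])
    finally show ?thesis by simp
  qed
  show ?thesis
    using recover[OF gh(1)] recover[OF gh(2)] eq by simp
qed

end

text \<open>
  The unit and the counit have the shape in which the composites of \<open>L\<close> and \<open>R\<close> with the tensor-hom
  adjunctions present themselves.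
\<close>

lemma adjunction_comp:
  assumes "adjunction A B L1 R1 u1 e1" "adjunction B C L2 R2 u2 e2"
  shows "adjunction A C (L2 \<circ>\<^sub>F L1) (R1 \<circ>\<^sub>F R2)
    (\<lambda>a. ArF R1 (u2 (ObF L1 a)) \<cdot>\<^bsub>A\<^esub> u1 a) (\<lambda>c. e2 c \<cdot>\<^bsub>C\<^esub> ArF L2 (e1 (ObF R2 c)))"
proof -
  interpret P: adjunction A B L1 R1 u1 e1 by fact
  interpret Q: adjunction B C L2 R2 u2 e2 by fact
  have L: "cat_functor A C (L2 \<circ>\<^sub>F L1)"
    using P.L.cat_functor_axioms Q.L.cat_functor_axioms by (rule cat_functor_comp)
  have R: "cat_functor C A (R1 \<circ>\<^sub>F R2)"
    using Q.R.cat_functor_axioms P.R.cat_functor_axioms by (rule cat_functor_comp)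
  have unit: "nat_trans A A id_func (R1 \<circ>\<^sub>F R2 \<circ>\<^sub>F (L2 \<circ>\<^sub>F L1))
      (\<lambda>a. ArF R1 (u2 (ObF L1 a)) \<cdot>\<^bsub>A\<^esub> u1 a)"
  proof (rule nat_transI)
    fix f assume f: "f \<in> Arr A"
    have 1: "u1 (Cod A f) \<cdot>\<^bsub>A\<^esub> f = ArF R1 (ArF L1 f) \<cdot>\<^bsub>A\<^esub> u1 (Dom A f)"
      using P.unit.naturality_eq[OF f] by simp
    have "u2 (Cod B (ArF L1 f)) \<cdot>\<^bsub>B\<^esub> ArF L1 f
        = ArF R2 (ArF L2 (ArF L1 f)) \<cdot>\<^bsub>B\<^esub> u2 (Dom B (ArF L1 f))"
      using f Q.unit.naturality_eq[of "ArF L1 f"] by simp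
    then have "ArF R1 (u2 (ObF L1 (Cod A f)) \<cdot>\<^bsub>B\<^esub> ArF L1 f)
        = ArF R1 (ArF R2 (ArF L2 (ArF L1 f)) \<cdot>\<^bsub>B\<^esub> u2 (ObF L1 (Dom A f)))"
      using f by simp
    then have 2: "ArF R1 (u2 (ObF L1 (Cod A f))) \<cdot>\<^bsub>A\<^esub> ArF R1 (ArF L1 f)
        = ArF R1 (ArF R2 (ArF L2 (ArF L1 f))) \<cdot>\<^bsub>A\<^esub> ArF R1 (u2 (ObF L1 (Dom A f)))"
      using f by (simp add: P.R.ArF_Comp_eq)
    show "ArF R1 (u2 (ObF L1 (Cod A f))) \<cdot>\<^bsub>A\<^esub> u1 (Cod A f) \<cdot>\<^bsub>A\<^esub> ArF id_func f
        = ArF (R1 \<circ>\<^sub>F R2 \<circ>\<^sub>F (L2 \<circ>\<^sub>F L1)) f \<cdot>\<^bsub>A\<^esub> (ArF R1 (u2 (ObF L1 (Dom A f))) \<cdot>\<^bsub>A\<^esub> u1 (Dom A f))"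
      using f by (simp add: 1 P.L.C.Comp_eq_extend[OF 2])
  qed (simp_all add: cat_functor_comp[OF L R] P.unit.F.cat_functor_axioms)
  have counit: "nat_trans C C (L2 \<circ>\<^sub>F L1 \<circ>\<^sub>F (R1 \<circ>\<^sub>F R2)) id_func
      (\<lambda>c. e2 c \<cdot>\<^bsub>C\<^esub> ArF L2 (e1 (ObF R2 c)))"
  proof (rule nat_transI)
    fix f assume f: "f \<in> Arr C"
    have 1: "e2 (Cod C f) \<cdot>\<^bsub>C\<^esub> ArF L2 (ArF R2 f) = f \<cdot>\<^bsub>C\<^esub> e2 (Dom C f)"
      using Q.counit.naturality_eq[OF f] by simp
    have "ArF L2 (e1 (ObF R2 (Cod C f)) \<cdot>\<^bsub>B\<^esub> ArF L1 (ArF R1 (ArF R2 f)))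
        = ArF L2 (ArF R2 f \<cdot>\<^bsub>B\<^esub> e1 (ObF R2 (Dom C f)))"
      using f P.counit.naturality_eq[of "ArF R2 f"] by simp
    then have 2: "ArF L2 (e1 (ObF R2 (Cod C f))) \<cdot>\<^bsub>C\<^esub> ArF L2 (ArF L1 (ArF R1 (ArF R2 f)))
        = ArF L2 (ArF R2 f) \<cdot>\<^bsub>C\<^esub> ArF L2 (e1 (ObF R2 (Dom C f)))"
      using f by (simp add: Q.L.ArF_Comp_eq)
    show "e2 (Cod C f) \<cdot>\<^bsub>C\<^esub> ArF L2 (e1 (ObF R2 (Cod C f))) \<cdot>\<^bsub>C\<^esub> ArF (L2 \<circ>\<^sub>F L1 \<circ>\<^sub>F (R1 \<circ>\<^sub>F R2)) f
        = ArF id_func f \<cdot>\<^bsub>C\<^esub> (e2 (Dom C f) \<cdot>\<^bsub>C\<^esub> ArF L2 (e1 (ObF R2 (Dom C f))))"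
      using f by (simp add: 2 Q.L.D.Comp_eq_extend[OF 1])
  qed (simp_all add: cat_functor_comp[OF R L] Q.counit.G.cat_functor_axioms)
  have triangle_L: "e2 (ObF L2 (ObF L1 a)) \<cdot>\<^bsub>C\<^esub> ArF L2 (e1 (ObF R2 (ObF L2 (ObF L1 a))))
      \<cdot>\<^bsub>C\<^esub> ArF L2 (ArF L1 (ArF R1 (u2 (ObF L1 a)) \<cdot>\<^bsub>A\<^esub> u1 a)) = Id C (ObF L2 (ObF L1 a))"
    if a: "a \<in> Obj A" for a
  proof -
    let ?v = "u2 (ObF L1 a)"
    have "e1 (ObF R2 (ObF L2 (ObF L1 a))) \<cdot>\<^bsub>B\<^esub> ArF L1 (ArF R1 ?v) = ?v \<cdot>\<^bsub>B\<^esub> e1 (ObF L1 a)"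
      using a P.counit.naturality_eq[of ?v] by simp
    from P.L.D.Comp_eq_extend[OF this, of "ArF L1 (u1 a)"]
    have "e1 (ObF R2 (ObF L2 (ObF L1 a))) \<cdot>\<^bsub>B\<^esub> ArF L1 (ArF R1 ?v \<cdot>\<^bsub>A\<^esub> u1 a) = ?v"
      using a by (simp add: P.L.ArF_Comp_eq P.triangle_L)
    then have "ArF L2 (e1 (ObF R2 (ObF L2 (ObF L1 a))))
        \<cdot>\<^bsub>C\<^esub> ArF L2 (ArF L1 (ArF R1 ?v \<cdot>\<^bsub>A\<^esub> u1 a)) = ArF L2 ?v"
      using a by (simp add: Q.L.ArF_Comp_eq[symmetric])
    then show ?thesis
      using a by (simp add: Q.triangle_L)
  qed
  have triangle_R: "ArF R1 (ArF R2 (e2 c \<cdot>\<^bsub>C\<^esub> ArF L2 (e1 (ObF R2 c))))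
      \<cdot>\<^bsub>A\<^esub> (ArF R1 (u2 (ObF L1 (ObF R1 (ObF R2 c)))) \<cdot>\<^bsub>A\<^esub> u1 (ObF R1 (ObF R2 c)))
      = Id A (ObF R1 (ObF R2 c))"
    if c: "c \<in> Obj C" for c
  proof -
    let ?f = "e1 (ObF R2 c)"
    have "u2 (ObF R2 c) \<cdot>\<^bsub>B\<^esub> ?f = ArF R2 (ArF L2 ?f) \<cdot>\<^bsub>B\<^esub> u2 (ObF L1 (ObF R1 (ObF R2 c)))"
      using c Q.unit.naturality_eq[of ?f] by simp
    then have "ArF R2 (e2 c \<cdot>\<^bsub>C\<^esub> ArF L2 ?f) \<cdot>\<^bsub>B\<^esub> u2 (ObF L1 (ObF R1 (ObF R2 c)))
        = ArF R2 (e2 c) \<cdot>\<^bsub>B\<^esub> (u2 (ObF R2 c) \<cdot>\<^bsub>B\<^esub> ?f)"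
      using c by (simp add: Q.R.ArF_Comp_eq)
    also have "\<dots> = ?f"
      using c by (simp add: P.L.D.Comp_eq_extend[OF Q.triangle_R])
    finally have "ArF R1 (ArF R2 (e2 c \<cdot>\<^bsub>C\<^esub> ArF L2 ?f))
        \<cdot>\<^bsub>A\<^esub> ArF R1 (u2 (ObF L1 (ObF R1 (ObF R2 c)))) = ArF R1 ?f"
      using c by (simp add: P.R.ArF_Comp_eq[symmetric])
    from P.L.C.Comp_eq_extend[OF this, of "u1 (ObF R1 (ObF R2 c))"]
    show ?thesis
      using c by (simp add: P.triangle_R)
  qed
  show ?thesis
    using L R unit counit triangle_L triangle_R
    by (auto simp: adjunction_def adjunction_axioms_def)
qed

text \<open>
  Conjugacy of \<open>\<sigma>\<close> and \<open>\<tau>\<close> is expressed by compatibility with the counits, which says that the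
  transpose of \<open>\<tau> d\<close> under \<open>F -| G\<close> is \<open>\<epsilon>' d \<cdot> \<sigma> (G' d)\<close>. This determines \<open>\<tau>\<close> from \<open>\<sigma>\<close>.
\<close>

locale conjugate_pair =
    l: adjunction C D F G \<eta> \<epsilon> + r: adjunction C D F' G' \<eta>' \<epsilon>' +
    \<sigma>: nat_trans C D F F' \<sigma> + \<tau>: nat_trans D C G' G \<tau>
  for C :: "('o, 'a, 'm) cat_scheme" and D :: "('p, 'b, 'n) cat_scheme"
    and F G \<eta> \<epsilon> F' G' \<eta>' \<epsilon>' \<sigma> \<tau> +
  assumes counit_square: "d \<in> Obj D \<Longrightarrow> \<epsilon>' d \<cdot>\<^bsub>D\<^esub> \<sigma> (ObF G' d) = \<epsilon> d \<cdot>\<^bsub>D\<^esub> ArF F (\<tau> d)"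
begin

text \<open>
  Compatibility with the counits is equivalent to compatibility with the units: both sides here
  have transpose \<open>\<sigma> c\<close>.
\<close>

lemma unit_square:
  assumes c: "c \<in> Obj C"
  shows "\<tau> (ObF F' c) \<cdot>\<^bsub>C\<^esub> \<eta>' c = ArF G (\<sigma> c) \<cdot>\<^bsub>C\<^esub> \<eta> c"
proof (rule l.transpose_inject)
  have "\<epsilon> (ObF F' c) \<cdot>\<^bsub>D\<^esub> ArF F (\<tau> (ObF F' c) \<cdot>\<^bsub>C\<^esub> \<eta>' c)
      = \<epsilon>' (ObF F' c) \<cdot>\<^bsub>D\<^esub> (\<sigma> (ObF G' (ObF F' c)) \<cdot>\<^bsub>D\<^esub> ArF F (\<eta>' c))"
    using c by (simp add: l.L.ArF_Comp_eq l.L.D.Comp_eq_extend[OF counit_square])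
  also have "\<dots> = \<epsilon>' (ObF F' c) \<cdot>\<^bsub>D\<^esub> (ArF F' (\<eta>' c) \<cdot>\<^bsub>D\<^esub> \<sigma> c)"
    using c \<sigma>.naturality_eq[of "\<eta>' c"] by simp
  also have "\<dots> = \<sigma> c"
    using c by (simp add: l.L.D.Comp_eq_extend[OF r.triangle_L])
  also have "\<dots> = \<sigma> c \<cdot>\<^bsub>D\<^esub> (\<epsilon> (ObF F c) \<cdot>\<^bsub>D\<^esub> ArF F (\<eta> c))"
    using c by (simp add: l.triangle_L)
  also have "\<dots> = \<epsilon> (ObF F' c) \<cdot>\<^bsub>D\<^esub> ArF F (ArF G (\<sigma> c) \<cdot>\<^bsub>C\<^esub> \<eta> c)"
    using c l.counit.naturality_eq[of "\<sigma> c"]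
      l.L.D.Comp_eq_extend[of "\<epsilon> (ObF F' c)" "ArF F (ArF G (\<sigma> c))" _ "ArF F (\<eta> c)"]
    by (simp add: l.L.ArF_Comp_eq)
  finally show "\<epsilon> (ObF F' c) \<cdot>\<^bsub>D\<^esub> ArF F (\<tau> (ObF F' c) \<cdot>\<^bsub>C\<^esub> \<eta>' c)
      = \<epsilon> (ObF F' c) \<cdot>\<^bsub>D\<^esub> ArF F (ArF G (\<sigma> c) \<cdot>\<^bsub>C\<^esub> \<eta> c)" .
qed (use c in \<open>simp_all add: Hom_iff\<close>)

text \<open>
  The candidate inverse is the conjugate of the inverse of \<open>\<tau>\<close>. One composite with \<open>\<sigma> c\<close> reduces to
  a triangle identity of \<open>F -| G\<close> by the counit square, the other to a triangle identity of
  \<open>F' -| G'\<close> by the unit square.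
\<close>

lemma left_inverse_if_right_iso:
  assumes iso: "\<And>d. d \<in> Obj D \<Longrightarrow> is_iso C (\<tau> d)" and c: "c \<in> Obj C"
  shows "inverse_arrows D (\<sigma> c)
    (\<epsilon>' (ObF F c) \<cdot>\<^bsub>D\<^esub> ArF F' (inv_arr C (\<tau> (ObF F c)) \<cdot>\<^bsub>C\<^esub> \<eta> c))"
proof -
  define \<psi> where "\<psi> d = inv_arr C (\<tau> d)" for d
  interpret \<psi>: nat_trans D C G G' \<psi>
    unfolding \<psi>_def using \<tau>.nat_trans_axioms iso by (rule nat_trans_inverse)
  have inv: "\<psi> d \<cdot>\<^bsub>C\<^esub> \<tau> d = Id C (ObF G' d)" "\<tau> d \<cdot>\<^bsub>C\<^esub> \<psi> d = Id C (ObF G d)" if "d \<in> Obj D" for d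
    using that iso by (simp_all add: \<psi>_def)
  define k where "k = \<psi> (ObF F c) \<cdot>\<^bsub>C\<^esub> \<eta> c"
  have k: "k \<in> Arr C" "Dom C k = c" "Cod C k = ObF G' (ObF F c)"
    using c by (simp_all add: k_def)
  have "\<epsilon>' (ObF F c) \<cdot>\<^bsub>D\<^esub> ArF F' k \<cdot>\<^bsub>D\<^esub> \<sigma> c
      = \<epsilon>' (ObF F c) \<cdot>\<^bsub>D\<^esub> (\<sigma> (ObF G' (ObF F c)) \<cdot>\<^bsub>D\<^esub> ArF F k)"
    using c k \<sigma>.naturality_eq[of k] by simp
  also have "\<dots> = \<epsilon> (ObF F c) \<cdot>\<^bsub>D\<^esub> ArF F (\<tau> (ObF F c) \<cdot>\<^bsub>C\<^esub> k)"
    using c k by (simp add: l.L.ArF_Comp_eq l.L.D.Comp_eq_extend[OF counit_square])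
  also have "\<tau> (ObF F c) \<cdot>\<^bsub>C\<^esub> k = \<eta> c"
    using c by (simp add: k_def l.L.C.Comp_eq_extend[OF inv(2)])
  finally have 1: "\<epsilon>' (ObF F c) \<cdot>\<^bsub>D\<^esub> ArF F' k \<cdot>\<^bsub>D\<^esub> \<sigma> c = Id D (ObF F c)"
    using c by (simp add: l.triangle_L)
  have "ArF G' (\<sigma> c) \<cdot>\<^bsub>C\<^esub> k = \<psi> (ObF F' c) \<cdot>\<^bsub>C\<^esub> (ArF G (\<sigma> c) \<cdot>\<^bsub>C\<^esub> \<eta> c)"
    using c \<psi>.naturality_eq[of "\<sigma> c"]
      l.L.C.Comp_eq_extend[of "\<psi> (ObF F' c)" "ArF G (\<sigma> c)" _ "\<eta> c"] by (simp add: k_def)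
  also have "\<dots> = \<psi> (ObF F' c) \<cdot>\<^bsub>C\<^esub> (\<tau> (ObF F' c) \<cdot>\<^bsub>C\<^esub> \<eta>' c)"
    using c by (simp add: unit_square)
  also have "\<dots> = \<eta>' c"
    using c by (simp add: l.L.C.Comp_eq_extend[OF inv(1)])
  finally have Gk: "ArF G' (\<sigma> c) \<cdot>\<^bsub>C\<^esub> k = \<eta>' c" .
  have "\<sigma> c \<cdot>\<^bsub>D\<^esub> (\<epsilon>' (ObF F c) \<cdot>\<^bsub>D\<^esub> ArF F' k)
      = \<epsilon>' (ObF F' c) \<cdot>\<^bsub>D\<^esub> ArF F' (ArF G' (\<sigma> c) \<cdot>\<^bsub>C\<^esub> k)"
    using c k r.counit.naturality_eq[of "\<sigma> c"]
      l.L.D.Comp_eq_extend[of "\<epsilon>' (ObF F' c)" "ArF F' (ArF G' (\<sigma> c))" _ "ArF F' k"]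
    by (simp add: r.L.ArF_Comp_eq)
  then have 2: "\<sigma> c \<cdot>\<^bsub>D\<^esub> (\<epsilon>' (ObF F c) \<cdot>\<^bsub>D\<^esub> ArF F' k) = Id D (ObF F' c)"
    using c by (simp add: Gk r.triangle_L)
  show ?thesis
    using c k 1 2 unfolding k_def[unfolded \<psi>_def, symmetric]
    by (simp add: inverse_arrows_def Hom_iff)
qed

text \<open>
  Dually, the candidate is the conjugate of the inverse of \<open>\<sigma>\<close>. The squares exchange their roles:
  the unit square leads to a triangle identity of \<open>F -| G\<close>, the counit square to one of \<open>F' -| G'\<close>.
\<close>

lemma right_inverse_if_left_iso:
  assumes iso: "\<And>c. c \<in> Obj C \<Longrightarrow> is_iso D (\<sigma> c)" and d: "d \<in> Obj D"
  shows "inverse_arrows C (\<tau> d)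
    (ArF G' (\<epsilon> d \<cdot>\<^bsub>D\<^esub> inv_arr D (\<sigma> (ObF G d))) \<cdot>\<^bsub>C\<^esub> \<eta>' (ObF G d))"
proof -
  define \<rho> where "\<rho> c = inv_arr D (\<sigma> c)" for c
  interpret \<rho>: nat_trans C D F' F \<rho>
    unfolding \<rho>_def using \<sigma>.nat_trans_axioms iso by (rule nat_trans_inverse)
  have inv: "\<rho> c \<cdot>\<^bsub>D\<^esub> \<sigma> c = Id D (ObF F c)" "\<sigma> c \<cdot>\<^bsub>D\<^esub> \<rho> c = Id D (ObF F' c)" if "c \<in> Obj C" for c
    using that iso by (simp_all add: \<rho>_def)
  define k where "k = \<epsilon> d \<cdot>\<^bsub>D\<^esub> \<rho> (ObF G d)"
  have k: "k \<in> Arr D" "Dom D k = ObF F' (ObF G d)" "Cod D k = d"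
    using d by (simp_all add: k_def)
  have "\<tau> d \<cdot>\<^bsub>C\<^esub> (ArF G' k \<cdot>\<^bsub>C\<^esub> \<eta>' (ObF G d))
      = ArF G k \<cdot>\<^bsub>C\<^esub> (\<tau> (ObF F' (ObF G d)) \<cdot>\<^bsub>C\<^esub> \<eta>' (ObF G d))"
    using d k \<tau>.naturality_eq[of k] l.L.C.Comp_eq_extend[of "\<tau> d" "ArF G' k" _ "\<eta>' (ObF G d)"]
    by simp
  also have "\<dots> = ArF G (k \<cdot>\<^bsub>D\<^esub> \<sigma> (ObF G d)) \<cdot>\<^bsub>C\<^esub> \<eta> (ObF G d)"
    using d k by (simp add: unit_square l.R.ArF_Comp_eq)
  also have "k \<cdot>\<^bsub>D\<^esub> \<sigma> (ObF G d) = \<epsilon> d"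
    using d by (simp add: k_def inv)
  finally have 1: "\<tau> d \<cdot>\<^bsub>C\<^esub> (ArF G' k \<cdot>\<^bsub>C\<^esub> \<eta>' (ObF G d)) = Id C (ObF G d)"
    using d by (simp add: l.triangle_R)
  have "k \<cdot>\<^bsub>D\<^esub> ArF F' (\<tau> d) = \<epsilon> d \<cdot>\<^bsub>D\<^esub> ArF F (\<tau> d) \<cdot>\<^bsub>D\<^esub> \<rho> (ObF G' d)"
    using d \<rho>.naturality_eq[of "\<tau> d"] by (simp add: k_def)
  also have "\<dots> = \<epsilon>' d \<cdot>\<^bsub>D\<^esub> (\<sigma> (ObF G' d) \<cdot>\<^bsub>D\<^esub> \<rho> (ObF G' d))"
    using d by (simp add: counit_square[symmetric] del: l.L.D.Comp_assoc_eq)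
      (simp add: inv)
  also have "\<dots> = \<epsilon>' d"
    using d by (simp add: inv)
  finally have kF: "k \<cdot>\<^bsub>D\<^esub> ArF F' (\<tau> d) = \<epsilon>' d" .
  have "ArF G' k \<cdot>\<^bsub>C\<^esub> \<eta>' (ObF G d) \<cdot>\<^bsub>C\<^esub> \<tau> d
      = ArF G' (k \<cdot>\<^bsub>D\<^esub> ArF F' (\<tau> d)) \<cdot>\<^bsub>C\<^esub> \<eta>' (ObF G' d)"
    using d k r.unit.naturality_eq[of "\<tau> d"] by (simp add: r.R.ArF_Comp_eq)
  then have 2: "ArF G' k \<cdot>\<^bsub>C\<^esub> \<eta>' (ObF G d) \<cdot>\<^bsub>C\<^esub> \<tau> d = Id C (ObF G' d)"
    using d by (simp add: kF r.triangle_R)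
  show ?thesis
    using d k 1 2 unfolding k_def[unfolded \<rho>_def, symmetric]
    by (simp add: inverse_arrows_def Hom_iff)
qed

end

section \<open>Tensor products and internal homs\<close>

context monoidal_category
begin

lemma tensor_Id [simp]: "\<lbrakk>a \<in> Obj C; b \<in> Obj C\<rbrakk> \<Longrightarrow> Id C a \<otimes>\<^sub>a Id C b = Id C (a \<otimes> b)"
  using tensor.ArF_Id[of "(a, b)"] by simp

lemma tensor_Comp:
  "\<lbrakk>f \<in> Arr C; f' \<in> Arr C; Dom C f' = Cod C f; g \<in> Arr C; g' \<in> Arr C; Dom C g' = Cod C g\<rbrakk>
    \<Longrightarrow> (f' \<otimes>\<^sub>a g') \<cdot> (f \<otimes>\<^sub>a g) = (f' \<cdot> f) \<otimes>\<^sub>a (g' \<cdot> g)"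
  using tensor.ArF_Comp_eq[of "(f, g)" "(f', g')"] by simp

end

context left_closed_monoidal_category
begin

lemma ihom_Id [simp]: "\<lbrakk>a \<in> Obj C; b \<in> Obj C\<rbrakk> \<Longrightarrow> Id C a \<rightharpoonup>\<^sub>a Id C b = Id C (a \<rightharpoonup> b)"
  using ihom.ArF_Id[of "(a, b)"] by simp

lemma ihom_Comp:
  "\<lbrakk>f \<in> Arr C; f' \<in> Arr C; Dom C f = Cod C f'; g \<in> Arr C; g' \<in> Arr C; Dom C g' = Cod C g\<rbrakk>
    \<Longrightarrow> (f' \<rightharpoonup>\<^sub>a g') \<cdot> (f \<rightharpoonup>\<^sub>a g) = (f \<cdot> f') \<rightharpoonup>\<^sub>a (g' \<cdot> g)"
  using ihom.ArF_Comp_eq[of "(f, g)" "(f', g')"] by simp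

lemma Ev_arrow [simp]:
  assumes "c \<in> Obj C" "a \<in> Obj C"
  shows "Ev C c a \<in> Arr C" "Dom C (Ev C c a) = c \<otimes> (c \<rightharpoonup> a)" "Cod C (Ev C c a) = a"
proof -
  interpret adj: adjunction C C "\<lparr>ObF = (\<lambda>a. c \<otimes> a), ArF = (\<lambda>f. Id C c \<otimes>\<^sub>a f)\<rparr>"
    "\<lparr>ObF = (\<lambda>a. c \<rightharpoonup> a), ArF = (\<lambda>f. Id C c \<rightharpoonup>\<^sub>a f)\<rparr>" "\<lambda>a. Coev C c a" "\<lambda>a. Ev C c a"
    using assms by (intro tensor_hom_adjunction)
  show "Ev C c a \<in> Arr C" "Dom C (Ev C c a) = c \<otimes> (c \<rightharpoonup> a)" "Cod C (Ev C c a) = a"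
    using assms adj.counit.component_arrow[of a] by simp_all
qed

lemma Coev_arrow [simp]:
  assumes "c \<in> Obj C" "a \<in> Obj C"
  shows "Coev C c a \<in> Arr C" "Dom C (Coev C c a) = a" "Cod C (Coev C c a) = c \<rightharpoonup> (c \<otimes> a)"
proof -
  interpret adj: adjunction C C "\<lparr>ObF = (\<lambda>a. c \<otimes> a), ArF = (\<lambda>f. Id C c \<otimes>\<^sub>a f)\<rparr>"
    "\<lparr>ObF = (\<lambda>a. c \<rightharpoonup> a), ArF = (\<lambda>f. Id C c \<rightharpoonup>\<^sub>a f)\<rparr>" "\<lambda>a. Coev C c a" "\<lambda>a. Ev C c a"
    using assms by (intro tensor_hom_adjunction)
  show "Coev C c a \<in> Arr C" "Dom C (Coev C c a) = a" "Cod C (Coev C c a) = c \<rightharpoonup> (c \<otimes> a)"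
    using assms adj.unit.component_arrow[of a] by simp_all
qed

text \<open>
  The universal property of the internal hom in the form needed below: arrows into \<open>c \<rightharpoonup> b\<close> are
  computed and compared after tensoring with \<open>c\<close> and evaluating, which removes the coevaluations
  from the calculations.
\<close>

lemma Ev_transpose:
  assumes "c \<in> Obj C" "a \<in> Obj C" "g \<in> Arr C" "Dom C g = c \<otimes> a" "Cod C g = b"
  shows "Ev C c b \<cdot> (Id C c \<otimes>\<^sub>a ((Id C c \<rightharpoonup>\<^sub>a g) \<cdot> Coev C c a)) = g"
  using adjunction.transpose_counit[OF tensor_hom_adjunction[of c], of g a] assms by simp

lemma Ev_inject:
  assumes "c \<in> Obj C" "b \<in> Obj C" "g \<in> Hom C a (c \<rightharpoonup> b)" "h \<in> Hom C a (c \<rightharpoonup> b)"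
    and "Ev C c b \<cdot> (Id C c \<otimes>\<^sub>a g) = Ev C c b \<cdot> (Id C c \<otimes>\<^sub>a h)"
  shows "g = h"
  using adjunction.transpose_inject[OF tensor_hom_adjunction[of c], of g a b h] assms by simp

text \<open>
  Naturality of evaluation in the covariant argument and extranaturality in the contravariant one
  combine because \<open>f \<rightharpoonup> g\<close> factors as \<open>(id \<rightharpoonup> g) \<cdot> (f \<rightharpoonup> id)\<close>.
\<close>

lemma Ev_natural:
  assumes f: "f \<in> Arr C" and g: "g \<in> Arr C"
  shows "Ev C (Dom C f) (Cod C g) \<cdot> (Id C (Dom C f) \<otimes>\<^sub>a (f \<rightharpoonup>\<^sub>a g))
    = g \<cdot> (Ev C (Cod C f) (Dom C g) \<cdot> (f \<otimes>\<^sub>a Id C (Cod C f \<rightharpoonup> Dom C g)))"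
proof -
  define c where "c = Dom C f"
  have c: "c \<in> Obj C" and cf: "Dom C f = c"
    using f by (simp_all add: c_def)
  interpret adj: adjunction C C "\<lparr>ObF = (\<lambda>a. c \<otimes> a), ArF = (\<lambda>f. Id C c \<otimes>\<^sub>a f)\<rparr>"
    "\<lparr>ObF = (\<lambda>a. c \<rightharpoonup> a), ArF = (\<lambda>f. Id C c \<rightharpoonup>\<^sub>a f)\<rparr>" "\<lambda>a. Coev C c a" "\<lambda>a. Ev C c a"
    using c by (rule tensor_hom_adjunction)
  let ?a = "Dom C g"
  have nat: "Ev C c (Cod C g) \<cdot> (Id C c \<otimes>\<^sub>a (Id C c \<rightharpoonup>\<^sub>a g)) = g \<cdot> Ev C c ?a"
    using adj.counit.naturality_eq[OF g] by simp
  have extra: "Ev C c ?a \<cdot> (Id C c \<otimes>\<^sub>a (f \<rightharpoonup>\<^sub>a Id C ?a))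
      = Ev C (Cod C f) ?a \<cdot> (f \<otimes>\<^sub>a Id C (Cod C f \<rightharpoonup> ?a))"
    using f g cf by (intro Ev_extranatural) (simp_all add: Hom_iff)
  have "f \<rightharpoonup>\<^sub>a g = (Id C c \<rightharpoonup>\<^sub>a g) \<cdot> (f \<rightharpoonup>\<^sub>a Id C ?a)"
    using f g c cf by (simp add: ihom_Comp)
  moreover have "Id C c \<otimes>\<^sub>a ((Id C c \<rightharpoonup>\<^sub>a g) \<cdot> (f \<rightharpoonup>\<^sub>a Id C ?a))
      = (Id C c \<otimes>\<^sub>a (Id C c \<rightharpoonup>\<^sub>a g)) \<cdot> (Id C c \<otimes>\<^sub>a (f \<rightharpoonup>\<^sub>a Id C ?a))"
    using f g c cf by (simp add: tensor_Comp)
  ultimately show ?thesis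
    using f g c cf by (simp add: Comp_eq_extend[OF nat] extra)
qed

end

section \<open>The projection and closed structure operators\<close>

locale monoidal_right_adjoint =
    X: left_closed_monoidal_category X + Y: left_closed_monoidal_category Y +
    adjunction X Y L R u e + R: monoidal_functor Y X R \<omega> \<omega>\<^sub>0
  for X :: "('o, 'a, 'm) closed_mon_cat_scheme" and Y :: "('p, 'b, 'n) closed_mon_cat_scheme"
    and L :: "('o, 'a, 'p, 'b) func" and R :: "('p, 'b, 'o, 'a) func"
    and u :: "'o \<Rightarrow> 'a" and e :: "'p \<Rightarrow> 'b"
    and \<omega> :: "'p \<Rightarrow> 'p \<Rightarrow> 'a" and \<omega>\<^sub>0 :: "'a"
begin

abbreviation \<pi> :: "'p \<Rightarrow> 'o \<Rightarrow> 'b" where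
  "\<pi> \<equiv> left_projection X Y L R u e \<omega>"

abbreviation \<omega>bar :: "'p \<Rightarrow> 'p \<Rightarrow> 'a" where
  "\<omega>bar \<equiv> closed_structure X Y R \<omega>"

lemma \<omega>_arrow [simp]:
  assumes "y \<in> Obj Y" "y' \<in> Obj Y"
  shows "\<omega> y y' \<in> Arr X" "Dom X (\<omega> y y') = ObF R y \<otimes>\<^bsub>X\<^esub> ObF R y'"
    "Cod X (\<omega> y y') = ObF R (y \<otimes>\<^bsub>Y\<^esub> y')"
  using R.lax.component_arrow[of "(y, y')"] assms by simp_all

lemma \<omega>_natural:
  assumes "g \<in> Arr Y" "g' \<in> Arr Y"
  shows "\<omega> (Cod Y g) (Cod Y g') \<cdot>\<^bsub>X\<^esub> (ArF R g \<otimes>\<^sub>a\<^bsub>X\<^esub> ArF R g')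
    = ArF R (g \<otimes>\<^sub>a\<^bsub>Y\<^esub> g') \<cdot>\<^bsub>X\<^esub> \<omega> (Dom Y g) (Dom Y g')"
  using R.lax.naturality_eq[of "(g, g')"] assms by simp

lemma left_projection_eq:
  assumes "y \<in> Obj Y" "x \<in> Obj X"
  shows "\<pi> y x = e (y \<otimes>\<^bsub>Y\<^esub> ObF L x)
    \<cdot>\<^bsub>Y\<^esub> ArF L (\<omega> y (ObF L x) \<cdot>\<^bsub>X\<^esub> (Id X (ObF R y) \<otimes>\<^sub>a\<^bsub>X\<^esub> u x))"
  using assms by (simp add: left_projection_def L.ArF_Comp_eq)

lemma left_projection_arrow [simp]:
  assumes "y \<in> Obj Y" "x \<in> Obj X"
  shows "\<pi> y x \<in> Arr Y" "Dom Y (\<pi> y x) = ObF L (ObF R y \<otimes>\<^bsub>X\<^esub> x)"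
    "Cod Y (\<pi> y x) = y \<otimes>\<^bsub>Y\<^esub> ObF L x"
  using assms by (simp_all add: left_projection_eq)

lemma closed_structure_eq:
  assumes "y \<in> Obj Y" "y' \<in> Obj Y"
  shows "\<omega>bar y y' = (Id X (ObF R y) \<rightharpoonup>\<^sub>a\<^bsub>X\<^esub> (ArF R (Ev Y y y') \<cdot>\<^bsub>X\<^esub> \<omega> y (y \<rightharpoonup>\<^bsub>Y\<^esub> y')))
    \<cdot>\<^bsub>X\<^esub> Coev X (ObF R y) (ObF R (y \<rightharpoonup>\<^bsub>Y\<^esub> y'))"
  using assms by (simp add: closed_structure_def X.ihom_Comp flip: X.Comp_assoc_eq)

lemma closed_structure_arrow [simp]:
  assumes "y \<in> Obj Y" "y' \<in> Obj Y"
  shows "\<omega>bar y y' \<in> Arr X" "Dom X (\<omega>bar y y') = ObF R (y \<rightharpoonup>\<^bsub>Y\<^esub> y')"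
    "Cod X (\<omega>bar y y') = ObF R y \<rightharpoonup>\<^bsub>X\<^esub> ObF R y'"
  using assms by (simp_all add: closed_structure_eq)

text \<open>
  The closed structure operator is the transpose of \<open>\<omega>\<close> followed by the image of evaluation. Every
  later argument uses only this characterisation.
\<close>

lemma Ev_closed_structure:
  assumes "y \<in> Obj Y" "y' \<in> Obj Y"
  shows "Ev X (ObF R y) (ObF R y') \<cdot>\<^bsub>X\<^esub> (Id X (ObF R y) \<otimes>\<^sub>a\<^bsub>X\<^esub> \<omega>bar y y')
    = ArF R (Ev Y y y') \<cdot>\<^bsub>X\<^esub> \<omega> y (y \<rightharpoonup>\<^bsub>Y\<^esub> y')"
  unfolding closed_structure_eq[OF assms] using assms by (intro X.Ev_transpose) simp_all

text \<open>
  Each of the three factors of \<open>\<pi>\<close> is natural: the square is assembled from those of \<open>u\<close>, \<open>\<omega>\<close>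
  and \<open>e\<close>.
\<close>

lemma left_projection_natural:
  assumes g: "g \<in> Arr Y" and f: "f \<in> Arr X"
  shows "\<pi> (Cod Y g) (Cod X f) \<cdot>\<^bsub>Y\<^esub> ArF L (ArF R g \<otimes>\<^sub>a\<^bsub>X\<^esub> f)
    = (g \<otimes>\<^sub>a\<^bsub>Y\<^esub> ArF L f) \<cdot>\<^bsub>Y\<^esub> \<pi> (Dom Y g) (Dom X f)"
proof -
  let ?y = "Dom Y g" and ?y' = "Cod Y g" and ?x = "Dom X f" and ?x' = "Cod X f"
  have u: "u ?x' \<cdot>\<^bsub>X\<^esub> f = ArF R (ArF L f) \<cdot>\<^bsub>X\<^esub> u ?x"
    using f unit.naturality_eq[of f] by simp
  have \<omega>: "\<omega> ?y' (ObF L ?x') \<cdot>\<^bsub>X\<^esub> (ArF R g \<otimes>\<^sub>a\<^bsub>X\<^esub> ArF R (ArF L f))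
      = ArF R (g \<otimes>\<^sub>a\<^bsub>Y\<^esub> ArF L f) \<cdot>\<^bsub>X\<^esub> \<omega> ?y (ObF L ?x)"
    using f g \<omega>_natural[of g "ArF L f"] by simp
  have e: "e (?y' \<otimes>\<^bsub>Y\<^esub> ObF L ?x') \<cdot>\<^bsub>Y\<^esub> ArF L (ArF R (g \<otimes>\<^sub>a\<^bsub>Y\<^esub> ArF L f))
      = (g \<otimes>\<^sub>a\<^bsub>Y\<^esub> ArF L f) \<cdot>\<^bsub>Y\<^esub> e (?y \<otimes>\<^bsub>Y\<^esub> ObF L ?x)"
    using f g counit.naturality_eq[of "g \<otimes>\<^sub>a\<^bsub>Y\<^esub> ArF L f"] by simp
  have "(Id X (ObF R ?y') \<otimes>\<^sub>a\<^bsub>X\<^esub> u ?x') \<cdot>\<^bsub>X\<^esub> (ArF R g \<otimes>\<^sub>a\<^bsub>X\<^esub> f)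
      = (ArF R g \<otimes>\<^sub>a\<^bsub>X\<^esub> ArF R (ArF L f)) \<cdot>\<^bsub>X\<^esub> (Id X (ObF R ?y) \<otimes>\<^sub>a\<^bsub>X\<^esub> u ?x)"
    using f g by (simp add: X.tensor_Comp u)
  then have "\<omega> ?y' (ObF L ?x') \<cdot>\<^bsub>X\<^esub> ((Id X (ObF R ?y') \<otimes>\<^sub>a\<^bsub>X\<^esub> u ?x') \<cdot>\<^bsub>X\<^esub> (ArF R g \<otimes>\<^sub>a\<^bsub>X\<^esub> f))
      = ArF R (g \<otimes>\<^sub>a\<^bsub>Y\<^esub> ArF L f)
        \<cdot>\<^bsub>X\<^esub> (\<omega> ?y (ObF L ?x) \<cdot>\<^bsub>X\<^esub> (Id X (ObF R ?y) \<otimes>\<^sub>a\<^bsub>X\<^esub> u ?x))"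
    using f g by (simp add: X.Comp_eq_extend[OF \<omega>])
  then have "\<pi> ?y' ?x' \<cdot>\<^bsub>Y\<^esub> ArF L (ArF R g \<otimes>\<^sub>a\<^bsub>X\<^esub> f)
      = e (?y' \<otimes>\<^bsub>Y\<^esub> ObF L ?x') \<cdot>\<^bsub>Y\<^esub> ArF L (ArF R (g \<otimes>\<^sub>a\<^bsub>Y\<^esub> ArF L f)
        \<cdot>\<^bsub>X\<^esub> (\<omega> ?y (ObF L ?x) \<cdot>\<^bsub>X\<^esub> (Id X (ObF R ?y) \<otimes>\<^sub>a\<^bsub>X\<^esub> u ?x)))"
    using f g by (simp add: left_projection_eq L.ArF_Comp_eq[symmetric])
  also have "\<dots> = (g \<otimes>\<^sub>a\<^bsub>Y\<^esub> ArF L f) \<cdot>\<^bsub>Y\<^esub> \<pi> ?y ?x"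
    using f g by (simp add: left_projection_eq L.ArF_Comp_eq Y.Comp_eq_extend[OF e])
  finally show ?thesis .
qed

text \<open>
  It suffices to compare transposes. Moving \<open>g \<rightharpoonup> g'\<close> through \<open>\<omega>\<close> and evaluation in \<open>Y\<close>, and
  \<open>R g \<rightharpoonup> R g'\<close> through evaluation in \<open>X\<close>, turns both into \<open>R g' \<cdot> R Ev \<cdot> \<omega> \<cdot> (R g \<otimes> id)\<close>.
\<close>

lemma closed_structure_natural:
  assumes g: "g \<in> Arr Y" and g': "g' \<in> Arr Y"
  shows "\<omega>bar (Dom Y g) (Cod Y g') \<cdot>\<^bsub>X\<^esub> ArF R (g \<rightharpoonup>\<^sub>a\<^bsub>Y\<^esub> g')
    = (ArF R g \<rightharpoonup>\<^sub>a\<^bsub>X\<^esub> ArF R g') \<cdot>\<^bsub>X\<^esub> \<omega>bar (Cod Y g) (Dom Y g')"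
proof (rule X.Ev_inject)
  let ?b = "Dom Y g" and ?a = "Cod Y g" and ?a' = "Dom Y g'" and ?b' = "Cod Y g'"
  let ?id = "Id X (ObF R ?b)" and ?ev = "Ev X (ObF R ?b) (ObF R ?b')"
  note gg = g g'
  have "?ev \<cdot>\<^bsub>X\<^esub> (?id \<otimes>\<^sub>a\<^bsub>X\<^esub> (\<omega>bar ?b ?b' \<cdot>\<^bsub>X\<^esub> ArF R (g \<rightharpoonup>\<^sub>a\<^bsub>Y\<^esub> g')))
      = ?ev \<cdot>\<^bsub>X\<^esub> (?id \<otimes>\<^sub>a\<^bsub>X\<^esub> \<omega>bar ?b ?b') \<cdot>\<^bsub>X\<^esub> (?id \<otimes>\<^sub>a\<^bsub>X\<^esub> ArF R (g \<rightharpoonup>\<^sub>a\<^bsub>Y\<^esub> g'))"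
    using gg by (simp add: X.tensor_Comp)
  also have "\<dots> = ArF R (Ev Y ?b ?b')
      \<cdot>\<^bsub>X\<^esub> (\<omega> ?b (?b \<rightharpoonup>\<^bsub>Y\<^esub> ?b') \<cdot>\<^bsub>X\<^esub> (ArF R (Id Y ?b) \<otimes>\<^sub>a\<^bsub>X\<^esub> ArF R (g \<rightharpoonup>\<^sub>a\<^bsub>Y\<^esub> g')))"
    using gg by (simp add: Ev_closed_structure del: X.Comp_assoc_eq) simp
  also have "\<dots> = ArF R (Ev Y ?b ?b' \<cdot>\<^bsub>Y\<^esub> (Id Y ?b \<otimes>\<^sub>a\<^bsub>Y\<^esub> (g \<rightharpoonup>\<^sub>a\<^bsub>Y\<^esub> g'))) \<cdot>\<^bsub>X\<^esub> \<omega> ?b (?a \<rightharpoonup>\<^bsub>Y\<^esub> ?a')"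
    using gg \<omega>_natural[of "Id Y ?b" "g \<rightharpoonup>\<^sub>a\<^bsub>Y\<^esub> g'"] by (simp add: R.ArF_Comp_eq)
  also have "\<dots> = ArF R g' \<cdot>\<^bsub>X\<^esub> (ArF R (Ev Y ?a ?a')
      \<cdot>\<^bsub>X\<^esub> (ArF R (g \<otimes>\<^sub>a\<^bsub>Y\<^esub> Id Y (?a \<rightharpoonup>\<^bsub>Y\<^esub> ?a')) \<cdot>\<^bsub>X\<^esub> \<omega> ?b (?a \<rightharpoonup>\<^bsub>Y\<^esub> ?a')))"
    using gg by (simp add: Y.Ev_natural R.ArF_Comp_eq)
  also have "\<dots> = ArF R g' \<cdot>\<^bsub>X\<^esub> (ArF R (Ev Y ?a ?a') \<cdot>\<^bsub>X\<^esub> \<omega> ?a (?a \<rightharpoonup>\<^bsub>Y\<^esub> ?a')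
      \<cdot>\<^bsub>X\<^esub> (ArF R g \<otimes>\<^sub>a\<^bsub>X\<^esub> Id X (ObF R (?a \<rightharpoonup>\<^bsub>Y\<^esub> ?a'))))"
    using gg \<omega>_natural[of g "Id Y (?a \<rightharpoonup>\<^bsub>Y\<^esub> ?a')"] by simp
  also have "\<dots> = ArF R g' \<cdot>\<^bsub>X\<^esub> (Ev X (ObF R ?a) (ObF R ?a')
      \<cdot>\<^bsub>X\<^esub> ((Id X (ObF R ?a) \<otimes>\<^sub>a\<^bsub>X\<^esub> \<omega>bar ?a ?a')
      \<cdot>\<^bsub>X\<^esub> (ArF R g \<otimes>\<^sub>a\<^bsub>X\<^esub> Id X (ObF R (?a \<rightharpoonup>\<^bsub>Y\<^esub> ?a')))))"
    using gg by (simp add: Ev_closed_structure[symmetric])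
  also have "(Id X (ObF R ?a) \<otimes>\<^sub>a\<^bsub>X\<^esub> \<omega>bar ?a ?a') \<cdot>\<^bsub>X\<^esub> (ArF R g \<otimes>\<^sub>a\<^bsub>X\<^esub> Id X (ObF R (?a \<rightharpoonup>\<^bsub>Y\<^esub> ?a')))
      = (ArF R g \<otimes>\<^sub>a\<^bsub>X\<^esub> Id X (ObF R ?a \<rightharpoonup>\<^bsub>X\<^esub> ObF R ?a')) \<cdot>\<^bsub>X\<^esub> (?id \<otimes>\<^sub>a\<^bsub>X\<^esub> \<omega>bar ?a ?a')"
    using gg by (simp add: X.tensor_Comp)
  also have "ArF R g' \<cdot>\<^bsub>X\<^esub> (Ev X (ObF R ?a) (ObF R ?a') \<cdot>\<^bsub>X\<^esub> \<dots>)
      = ?ev \<cdot>\<^bsub>X\<^esub> (?id \<otimes>\<^sub>a\<^bsub>X\<^esub> (ArF R g \<rightharpoonup>\<^sub>a\<^bsub>X\<^esub> ArF R g')) \<cdot>\<^bsub>X\<^esub> (?id \<otimes>\<^sub>a\<^bsub>X\<^esub> \<omega>bar ?a ?a')"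
    using gg X.Ev_natural[of "ArF R g" "ArF R g'"] by (simp del: X.Comp_assoc_eq) simp
  also have "\<dots> = ?ev \<cdot>\<^bsub>X\<^esub> (?id \<otimes>\<^sub>a\<^bsub>X\<^esub> ((ArF R g \<rightharpoonup>\<^sub>a\<^bsub>X\<^esub> ArF R g') \<cdot>\<^bsub>X\<^esub> \<omega>bar ?a ?a'))"
    using gg by (simp add: X.tensor_Comp)
  finally show "?ev \<cdot>\<^bsub>X\<^esub> (?id \<otimes>\<^sub>a\<^bsub>X\<^esub> (\<omega>bar ?b ?b' \<cdot>\<^bsub>X\<^esub> ArF R (g \<rightharpoonup>\<^sub>a\<^bsub>Y\<^esub> g')))
      = ?ev \<cdot>\<^bsub>X\<^esub> (?id \<otimes>\<^sub>a\<^bsub>X\<^esub> ((ArF R g \<rightharpoonup>\<^sub>a\<^bsub>X\<^esub> ArF R g') \<cdot>\<^bsub>X\<^esub> \<omega>bar ?a ?a'))" .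
qed (use g g' in \<open>simp_all add: Hom_iff\<close>)

lemma nat_trans_left_projection:
  "nat_trans (Y \<times>\<^sub>C X) Y (T_func X L R) (T'_func Y L) (\<lambda>(y, x). \<pi> y x)"
proof (rule nat_transI)
  show "cat_functor (Y \<times>\<^sub>C X) Y (T_func X L R)"
    by (rule cat_functorI)
      (auto simp: T_func_def category_prod_cat Y.category_axioms X.category_axioms
        X.tensor_Comp[symmetric] R.ArF_Comp_eq L.ArF_Comp_eq)
  show "cat_functor (Y \<times>\<^sub>C X) Y (T'_func Y L)"
    by (rule cat_functorI)
      (auto simp: T'_func_def category_prod_cat Y.category_axioms X.category_axioms
        Y.tensor_Comp[symmetric] L.ArF_Comp_eq)
qed (auto simp: T_func_def T'_func_def left_projection_natural)

lemma nat_trans_closed_structure: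
  "nat_trans (op_cat Y \<times>\<^sub>C Y) X (H'_func Y R) (H_func X R) (\<lambda>(y, y'). \<omega>bar y y')"
proof (rule nat_transI)
  show "cat_functor (op_cat Y \<times>\<^sub>C Y) X (H'_func Y R)"
    unfolding H'_func_def using Y.ihom.cat_functor_axioms R.cat_functor_axioms
    by (rule cat_functor_comp)
  show "cat_functor (op_cat Y \<times>\<^sub>C Y) X (H_func X R)"
    by (rule cat_functorI)
      (auto simp: H_func_def Y.ihom.C.category_axioms X.category_axioms
        X.ihom_Comp[symmetric] R.ArF_Comp_eq)
qed (auto simp: H_func_def H'_func_def closed_structure_natural)

text \<open>
  Naturality of \<open>e\<close> pulls the counit of \<open>T'(y, -) -| H'(y, -)\<close> inside \<open>L R\<close>; there naturality of
  \<open>\<omega>\<close> brings \<open>R (e (y \<rightharpoonup> y'))\<close> next to \<open>u\<close>, where a triangle identity cancels them. What remains is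
  the transpose of \<open>R (Ev y y') \<cdot> \<omega>\<close>, which is the right-hand side by \<open>Ev_closed_structure\<close>.
\<close>

lemma conjugate_square:
  assumes y: "y \<in> Obj Y" "y' \<in> Obj Y"
  shows "TH'_counit Y e y y' \<cdot>\<^bsub>Y\<^esub> \<pi> y (ObF R (y \<rightharpoonup>\<^bsub>Y\<^esub> y'))
    = e y' \<cdot>\<^bsub>Y\<^esub> ArF L (Ev X (ObF R y) (ObF R y'))
      \<cdot>\<^bsub>Y\<^esub> ArF L (Id X (ObF R y) \<otimes>\<^sub>a\<^bsub>X\<^esub> \<omega>bar y y')"
proof -
  let ?h = "y \<rightharpoonup>\<^bsub>Y\<^esub> y'" and ?id = "Id X (ObF R y)"
  let ?k = "TH'_counit Y e y y'"
  have k: "?k \<in> Arr Y" "Dom Y ?k = y \<otimes>\<^bsub>Y\<^esub> ObF L (ObF R ?h)" "Cod Y ?k = y'"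
    using y by (simp_all add: TH'_counit_def)
  have e: "e y' \<cdot>\<^bsub>Y\<^esub> ArF L (ArF R ?k) = ?k \<cdot>\<^bsub>Y\<^esub> e (y \<otimes>\<^bsub>Y\<^esub> ObF L (ObF R ?h))"
    using k counit.naturality_eq[of ?k] by simp
  have \<omega>: "ArF R (Id Y y \<otimes>\<^sub>a\<^bsub>Y\<^esub> e ?h) \<cdot>\<^bsub>X\<^esub> \<omega> y (ObF L (ObF R ?h))
      = \<omega> y ?h \<cdot>\<^bsub>X\<^esub> (?id \<otimes>\<^sub>a\<^bsub>X\<^esub> ArF R (e ?h))"
    using y \<omega>_natural[of "Id Y y" "e ?h"] by simp
  have "ArF R ?k \<cdot>\<^bsub>X\<^esub> (\<omega> y (ObF L (ObF R ?h)) \<cdot>\<^bsub>X\<^esub> (?id \<otimes>\<^sub>a\<^bsub>X\<^esub> u (ObF R ?h)))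
      = ArF R (Ev Y y y') \<cdot>\<^bsub>X\<^esub> (\<omega> y ?h
        \<cdot>\<^bsub>X\<^esub> ((?id \<otimes>\<^sub>a\<^bsub>X\<^esub> ArF R (e ?h)) \<cdot>\<^bsub>X\<^esub> (?id \<otimes>\<^sub>a\<^bsub>X\<^esub> u (ObF R ?h))))"
    using y by (simp add: TH'_counit_def R.ArF_Comp_eq X.Comp_eq_extend[OF \<omega>])
  also have "\<dots> = Ev X (ObF R y) (ObF R y') \<cdot>\<^bsub>X\<^esub> (?id \<otimes>\<^sub>a\<^bsub>X\<^esub> \<omega>bar y y')"
    using y by (simp add: X.tensor_Comp triangle_R Ev_closed_structure)
  finally have "e y' \<cdot>\<^bsub>Y\<^esub> ArF L (ArF R ?k
        \<cdot>\<^bsub>X\<^esub> (\<omega> y (ObF L (ObF R ?h)) \<cdot>\<^bsub>X\<^esub> (?id \<otimes>\<^sub>a\<^bsub>X\<^esub> u (ObF R ?h))))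
      = e y' \<cdot>\<^bsub>Y\<^esub> ArF L (Ev X (ObF R y) (ObF R y') \<cdot>\<^bsub>X\<^esub> (?id \<otimes>\<^sub>a\<^bsub>X\<^esub> \<omega>bar y y'))"
    by simp
  then show ?thesis
    using y k by (simp add: left_projection_eq L.ArF_Comp_eq Y.Comp_eq_extend[OF e])
qed

lemma conjugate_pair_at:
  assumes y: "y \<in> Obj Y"
  shows "conjugate_pair X Y
    (fix_first Y y (T_func X L R)) (fix_first (op_cat Y) y (H_func X R))
    (\<lambda>x. TH_unit X R u y x) (\<lambda>y'. e y' \<cdot>\<^bsub>Y\<^esub> ArF L (Ev X (ObF R y) (ObF R y')))
    (fix_first Y y (T'_func Y L)) (fix_first (op_cat Y) y (H'_func Y R))
    (\<lambda>x. ArF R (Coev Y y (ObF L x)) \<cdot>\<^bsub>X\<^esub> u x) (\<lambda>y'. TH'_counit Y e y y')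
    (\<lambda>x. \<pi> y x) (\<lambda>y'. \<omega>bar y y')"
proof -
  have Ry: "ObF R y \<in> Obj X"
    using y by simp
  \<comment> \<open>For fixed \<open>y\<close> the functors \<open>T, H\<close> and \<open>T', H'\<close> are composites of \<open>L, R\<close> with tensor-hom: with that
    of \<open>X\<close> at \<open>R y\<close>, applied before \<open>L\<close>, and with that of \<open>Y\<close> at \<open>y\<close>, applied after \<open>L\<close>.\<close>
  note adjs = adjunction_comp[OF X.tensor_hom_adjunction[OF Ry] adjunction_axioms]
    adjunction_comp[OF adjunction_axioms Y.tensor_hom_adjunction[OF y]]
  note nats = nat_trans_fix_first[OF nat_trans_left_projection Y.category_axioms X.category_axioms y]
  note nats' = nat_trans_fix_first[OF nat_trans_closed_structure _ Y.category_axioms, of y]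
  have op: "category (op_cat Y)"
    using Y.category_axioms by (rule category_op_cat)
  note defs = fix_first_def T_func_def T'_func_def H_func_def H'_func_def comp_func_def
    TH_unit_def TH'_counit_def o_def
  show ?thesis
    using adjs nats nats' op y conjugate_square
    by (simp add: conjugate_pair_def conjugate_pair_axioms_def defs)
qed

lemma projection_formula_iff_strong_left_closed:
  "projection_formula X Y L R u e \<omega> \<longleftrightarrow> strong_left_closed X Y R \<omega>"
proof
  assume pf: "projection_formula X Y L R u e \<omega>"
  show "strong_left_closed X Y R \<omega>"
    unfolding strong_left_closed_def
  proof (intro ballI)
    fix y y' assume y: "y \<in> Obj Y" "y' \<in> Obj Y"
    show "is_iso X (\<omega>bar y y')"
      using conjugate_pair.right_inverse_if_left_iso[OF conjugate_pair_at[OF y(1)] _ y(2)] pf y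
      unfolding projection_formula_def is_iso_def by blast
  qed
next
  assume sc: "strong_left_closed X Y R \<omega>"
  show "projection_formula X Y L R u e \<omega>"
    unfolding projection_formula_def
  proof (intro ballI)
    fix x y assume xy: "x \<in> Obj X" "y \<in> Obj Y"
    show "is_iso Y (\<pi> y x)"
      using conjugate_pair.left_inverse_if_right_iso[OF conjugate_pair_at[OF xy(2)] _ xy(1)] sc xy
      unfolding strong_left_closed_def is_iso_def by blast
  qed
qed

text \<open>
  The inverse constructed for conjugate pairs is literally the conjugate, up to splitting
  \<open>T'(y, \<omega>bar\<^sup>-\<^sup>1 \<cdot> \<eta>)\<close> into two factors; uniqueness of inverses does the rest.
\<close>

lemma inverse_left_projection_eq_conjugate:
  assumes sc: "strong_left_closed X Y R \<omega>" and x: "x \<in> Obj X" and y: "y \<in> Obj Y"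
  shows "inv_arr Y (\<pi> y x) = conjugate X Y L R u e (\<lambda>y y'. inv_arr X (\<omega>bar y y')) y x"
proof -
  interpret cp: conjugate_pair X Y
    "fix_first Y y (T_func X L R)" "fix_first (op_cat Y) y (H_func X R)"
    "\<lambda>x. TH_unit X R u y x" "\<lambda>y'. e y' \<cdot>\<^bsub>Y\<^esub> ArF L (Ev X (ObF R y) (ObF R y'))"
    "fix_first Y y (T'_func Y L)" "fix_first (op_cat Y) y (H'_func Y R)"
    "\<lambda>x. ArF R (Coev Y y (ObF L x)) \<cdot>\<^bsub>X\<^esub> u x" "\<lambda>y'. TH'_counit Y e y y'"
    "\<lambda>x. \<pi> y x" "\<lambda>y'. \<omega>bar y y'"
    using y by (rule conjugate_pair_at)
  let ?t = "ObF L (ObF R y \<otimes>\<^bsub>X\<^esub> x)"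
  have iso: "is_iso X (\<omega>bar y y')" if "y' \<in> Obj Y" for y'
    using sc y that by (simp add: strong_left_closed_def)
  have t: "?t \<in> Obj Y"
    using x y by simp
  have \<eta>: "TH_unit X R u y x \<in> Arr X" "Cod X (TH_unit X R u y x) = ObF R y \<rightharpoonup>\<^bsub>X\<^esub> ObF R ?t"
    using x y by (simp_all add: TH_unit_def)
  have "inv_arr Y (\<pi> y x) = TH'_counit Y e y ?t
      \<cdot>\<^bsub>Y\<^esub> (Id Y y \<otimes>\<^sub>a\<^bsub>Y\<^esub> ArF L (inv_arr X (\<omega>bar y ?t) \<cdot>\<^bsub>X\<^esub> TH_unit X R u y x))"
    using Y.inv_arr_eq[OF cp.left_inverse_if_right_iso[OF iso x]]
    by (simp add: fix_first_def T_func_def T'_func_def)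
  also have "\<dots> = conjugate X Y L R u e (\<lambda>y y'. inv_arr X (\<omega>bar y y')) y x"
    using x y t \<eta> iso[OF t]
    by (simp add: conjugate_def Let_def T_func_def T'_func_def TH'_counit_def L.ArF_Comp_eq
        Y.tensor_Comp)
  finally show ?thesis .
qed

end

theorem theorem5p1:
  fixes X :: "('o, 'a, 'm) closed_mon_cat_scheme"
    and Y :: "('p, 'b, 'n) closed_mon_cat_scheme"
    and L :: "('o, 'a, 'p, 'b) func" and R :: "('p, 'b, 'o, 'a) func"
    and u :: "'o \<Rightarrow> 'a" and e :: "'p \<Rightarrow> 'b"
    and \<omega> :: "'p \<Rightarrow> 'p \<Rightarrow> 'a" and \<omega>\<^sub>0 :: "'a"
  assumes "left_closed_monoidal_category X"
    and "left_closed_monoidal_category Y"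
    and "adjunction X Y L R u e"
    and "monoidal_functor Y X R \<omega> \<omega>\<^sub>0"
  shows "(projection_formula X Y L R u e \<omega> \<longleftrightarrow> strong_left_closed X Y R \<omega>) \<and>
    (projection_formula X Y L R u e \<omega> \<longrightarrow>
      nat_trans (op_cat Y \<times>\<^sub>C Y) X (H_func X R) (H'_func Y R)
        (\<lambda>(y, y'). inv_arr X (closed_structure X Y R \<omega> y y')) \<and>
      nat_trans (Y \<times>\<^sub>C X) Y (T'_func Y L) (T_func X L R)
        (\<lambda>(y, x). inv_arr Y (left_projection X Y L R u e \<omega> y x)) \<and>
      (\<forall>x\<in>Obj X. \<forall>y\<in>Obj Y.
        inv_arr Y (left_projection X Y L R u e \<omega> y x) =
          conjugate X Y L R u e (\<lambda>y y'. inv_arr X (closed_structure X Y R \<omega> y y')) y x))"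
proof -
  interpret monoidal_right_adjoint X Y L R u e \<omega> \<omega>\<^sub>0
    using assms by (simp add: monoidal_right_adjoint_def)
  show ?thesis
  proof (intro conjI impI ballI projection_formula_iff_strong_left_closed)
    assume pf: "projection_formula X Y L R u e \<omega>"
    then have sc: "strong_left_closed X Y R \<omega>"
      by (simp add: projection_formula_iff_strong_left_closed)
    show "nat_trans (op_cat Y \<times>\<^sub>C Y) X (H_func X R) (H'_func Y R)
        (\<lambda>(y, y'). inv_arr X (closed_structure X Y R \<omega> y y'))"
      using nat_trans_inverse[OF nat_trans_closed_structure] sc
      by (auto simp: strong_left_closed_def split_def)
    show "nat_trans (Y \<times>\<^sub>C X) Y (T'_func Y L) (T_func X L R)
        (\<lambda>(y, x). inv_arr Y (left_projection X Y L R u e \<omega> y x))"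
      using nat_trans_inverse[OF nat_trans_left_projection] pf
      by (auto simp: projection_formula_def split_def)
    fix x y assume "x \<in> Obj X" "y \<in> Obj Y"
    with sc show "inv_arr Y (left_projection X Y L R u e \<omega> y x) =
        conjugate X Y L R u e (\<lambda>y y'. inv_arr X (closed_structure X Y R \<omega> y y')) y x"
      by (rule inverse_left_projection_eq_conjugate)
  qed
qed

end
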